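(* Let $\mathcal{F}(i_1,j_1),\dots,\mathcal{F}(i_m,j_m)$ be $m$ pairwise different basic Drinfel'd twists (with $1\le i_s\ne j_s\le n$) such that $[\mathcal{F}(i_k,j_k),\mathcal{F}(i_s,j_s)]=0$ for all $1\le k\ne s\le m$. Then the product $\mathcal{F}(i_1,j_1)\cdots\mathcal{F}(i_m,j_m)$ is again a Drinfel'd twist on $U(\mathbf{S}^+)[[t]]$, where $\mathbf{S}^+$ is taken over a field of characteristic $0$.
   Context: Let $\mathbb{F}$ be a field of characteristic $0$, $D_i=\frac{\partial}{\partial x_i}$, $\partial_i=x_iD_i$, and $\mathbf{S}^+=\{\sum_{i=1}^na_iD_i\mid a_i\in\mathbb{F}[x_1,\dots,x_n],\ \sum D_i(a_i)=0\}$, a Lie algebra of derivations of $\mathbb{F}[x_1,\dots,x_n]$. For $1\le i\ne j\le n$ put $h(i,j)=\partial_i-\partial_j$, $e(i,j)=x_i(\partial_i-2\partial_j)\in\mathbf{S}^+$ (so $[h(i,j),e(i,j)]=e(i,j)$), and define the basic Drinfel'd twist $\mathcal{F}(i,j)=\sum_{r\ge0}\frac{(-1)^r}{r!}h(i,j)^{[r]}\otimes e(i,j)^rt^r$, where $x^{[r]}=x(x-1)\cdots(x-r+1)$. A Drinfel'd twist on a Hopf algebra $(A,\Delta_0,\varepsilon_0,S_0)$ is an invertible $\mathcal{F}\in A\otimes A$ with $(\mathcal{F}\otimes1)(\Delta_0\otimes\mathrm{Id})(\mathcal{F})=(1\otimes\mathcal{F})(\mathrm{Id}\otimes\Delta_0)(\mathcal{F})$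 and $(\varepsilon_0\otimes\mathrm{Id})(\mathcal{F})=1=(\mathrm{Id}\otimes\varepsilon_0)(\mathcal{F})$. $U(\mathbf{S}^+)[[t]]$ has the standard Hopf structure of the enveloping algebra, extended to $\mathbb{F}[[t]]$, with $t$-adically completed tensor products. *)

theory Defs
  imports "HOL-Library.Poly_Mapping" "HOL-Computational_Algebra.Formal_Power_Series"
begin

section \<open>Free vector spaces and monoid algebras\<close>

text \<open>
  The type \<open>'k \<Rightarrow>\<^sub>0 'a\<close> is the vector space with basis \<open>'k\<close>. If \<open>'k\<close> is an (additively written)
  monoid, the library makes it the monoid algebra, i.e. multiplication is convolution.
\<close>

abbreviation (input) lookup where "lookup \<equiv> Poly_Mapping.lookup"
abbreviation (input) single where "single \<equiv> Poly_Mapping.single"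
abbreviation (input) keys where "keys \<equiv> Poly_Mapping.keys"

definition pm_scale :: "'a::field \<Rightarrow> ('k \<Rightarrow>\<^sub>0 'a) \<Rightarrow> ('k \<Rightarrow>\<^sub>0 'a)" where
  "pm_scale c = Poly_Mapping.map ((*) c)"

lemma lookup_pm_scale [simp]: "lookup (pm_scale c p) k = c * lookup p k"
  by (simp add: pm_scale_def map.rep_eq when_def)

global_interpretation pm: vector_space "pm_scale :: 'a::field \<Rightarrow> ('k \<Rightarrow>\<^sub>0 'a) \<Rightarrow> ('k \<Rightarrow>\<^sub>0 'a)"
  by unfold_locales (auto intro!: poly_mapping_eqI simp: lookup_add algebra_simps)

lemma pm_scale_conv_mult:
  fixes p :: "'k::monoid_add \<Rightarrow>\<^sub>0 'a::field"
  shows "pm_scale c p = single 0 c * p"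
  unfolding pm_scale_def by (rule mult_map_scale_conv_mult)

lemma pm_scale_single [simp]: "pm_scale c (single k d) = single k (c * d)"
  by (rule poly_mapping_eqI) (auto simp: lookup_single when_def)

lemma pm_expand:
  fixes p :: "'k \<Rightarrow>\<^sub>0 'a::comm_monoid_add"
  shows "(\<Sum>k\<in>keys p. single k (lookup p k)) = p"
proof (rule poly_mapping_eqI)
  fix i
  have "lookup (\<Sum>k\<in>keys p. single k (lookup p k)) i = (\<Sum>k\<in>keys p. if k = i then lookup p k else 0)"
    by (auto simp: lookup_sum lookup_single when_def intro!: sum.cong)
  also have "\<dots> = lookup p i"
    by (simp add: sum.delta in_keys_iff)
  finally show "lookup (\<Sum>k\<in>keys p. single k (lookup p k)) i = lookup p i" .
qed

lemma pm_induct [case_names zero single add]: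
  fixes p :: "'k \<Rightarrow>\<^sub>0 'a::comm_monoid_add"
  assumes "P 0" "\<And>k c. P (single k c)" "\<And>p q. P p \<Longrightarrow> P q \<Longrightarrow> P (p + q)"
  shows "P p"
proof -
  have "P (\<Sum>k\<in>A. single k (lookup p k))" if "finite A" for A
    using that by (induction A) (auto intro: assms)
  from this[OF finite_keys, of p] show ?thesis by (simp only: pm_expand)
qed

lemma pm_mult_scale_right:
  fixes p q :: "'k::monoid_add \<Rightarrow>\<^sub>0 'a::field"
  shows "p * pm_scale c q = pm_scale c (p * q)"
proof -
  have comm: "p * single 0 c = single 0 c * p"
    by (induction p rule: pm_induct) (simp_all add: mult_single algebra_simps)
  show ?thesis by (simp add: pm_scale_conv_mult comm flip: mult.assoc)
qed

lemma pm_mult_scale_left: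
  fixes p q :: "'k::monoid_add \<Rightarrow>\<^sub>0 'a::field"
  shows "pm_scale c p * q = pm_scale c (p * q)"
  by (simp add: pm_scale_conv_mult mult.assoc)

text \<open>Linear extension of a map given on a basis.\<close>

definition lin_ext :: "('a::zero \<Rightarrow> 'v \<Rightarrow> 'v::comm_monoid_add) \<Rightarrow> ('k \<Rightarrow> 'v) \<Rightarrow> ('k \<Rightarrow>\<^sub>0 'a) \<Rightarrow> 'v" where
  "lin_ext sc f p = (\<Sum>k\<in>keys p. sc (lookup p k) (f k))"

context vector_space
begin

lemma lin_ext_superset:
  "finite A \<Longrightarrow> keys p \<subseteq> A \<Longrightarrow> lin_ext scale f p = (\<Sum>k\<in>A. scale (lookup p k) (f k))"
  unfolding lin_ext_def by (rule sum.mono_neutral_left) (auto simp: in_keys_iff)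

lemma lin_ext_add: "lin_ext scale f (p + q) = lin_ext scale f p + lin_ext scale f q"
proof -
  let ?A = "keys p \<union> keys q"
  have "keys (p + q) \<subseteq> ?A" by (rule keys_add)
  then show ?thesis
    by (simp add: lin_ext_superset[of ?A] lookup_add scale_left_distrib sum.distrib)
qed

lemma lin_ext_0 [simp]: "lin_ext scale f 0 = 0"
  by (simp add: lin_ext_def)

lemma lin_ext_single [simp]: "lin_ext scale f (single k c) = scale c (f k)"
  by (simp add: lin_ext_superset[of "{k}"])

lemma lin_ext_scale: "lin_ext scale f (pm_scale c p) = scale c (lin_ext scale f p)"
proof -
  have "keys (pm_scale c p) \<subseteq> keys p" by (auto simp: in_keys_iff)
  then show ?thesis
    by (simp add: lin_ext_superset[of "keys p"] scale_sum_right)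
qed

lemma lin_ext_minus: "lin_ext scale f (p - q) = lin_ext scale f p - lin_ext scale f q"
  using lin_ext_add[of f "p - q" q] by simp

lemma lin_ext_fun_add: "lin_ext scale (\<lambda>k. f k + g k) p = lin_ext scale f p + lin_ext scale g p"
  by (simp add: lin_ext_def scale_right_distrib sum.distrib)

lemma lin_ext_fun_scale: "lin_ext scale (\<lambda>k. scale c (f k)) p = scale c (lin_ext scale f p)"
  by (simp add: lin_ext_def scale_sum_right mult.commute)

lemma lin_ext_span_eq_0:
  assumes "\<And>r. r \<in> R \<Longrightarrow> lin_ext scale f r = 0" "p \<in> pm.span R"
  shows "lin_ext scale f p = 0"
  using assms(2)
  by (induction rule: pm.span_induct_alt) (simp_all add: lin_ext_add lin_ext_scale assms(1))

end

lemma lin_ext_mult: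
  fixes sc :: "'a::field \<Rightarrow> 'v::ring \<Rightarrow> 'v" and f :: "'k::monoid_add \<Rightarrow> 'v"
  assumes "vector_space sc"
    and scl: "\<And>c u v. sc c u * v = sc c (u * v)" and scr: "\<And>c u v. u * sc c v = sc c (u * v)"
    and hom: "\<And>k l. f (k + l) = f k * f l"
  shows "lin_ext sc f (p * q) = lin_ext sc f p * lin_ext sc f q"
proof -
  interpret vector_space sc by fact
  have 1: "lin_ext sc f (single k c * q) = sc c (f k) * lin_ext sc f q" for k c
    by (induction q rule: pm_induct)
       (simp_all add: mult_single algebra_simps lin_ext_add scl scr hom)
  show ?thesis
    by (induction p rule: pm_induct) (simp_all add: 1 algebra_simps lin_ext_add)
qed

text \<open>The two-sided ideal generated by a set.\<close>

definition ideal_gen :: "('k::monoid_add \<Rightarrow>\<^sub>0 'a::field) set \<Rightarrow> ('k \<Rightarrow>\<^sub>0 'a) set" where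
  "ideal_gen R = pm.span {a * r * b | a r b. r \<in> R}"

definition two_sided_ideal :: "('k::monoid_add \<Rightarrow>\<^sub>0 'a::field) set \<Rightarrow> bool" where
  "two_sided_ideal J \<longleftrightarrow> pm.subspace J \<and> (\<forall>p. \<forall>q\<in>J. p * q \<in> J \<and> q * p \<in> J)"

lemma two_sided_ideal_ideal_gen: "two_sided_ideal (ideal_gen R)"
proof -
  let ?S = "{a * r * b | a r b. r \<in> R}"
  have "p * q \<in> pm.span ?S \<and> q * p \<in> pm.span ?S" if "q \<in> pm.span ?S" for p q
    using that
  proof (induction rule: pm.span_induct_alt)
    case base
    then show ?case by (simp add: pm.span_zero)
  next
    case (step c x y)
    then obtain a r b where x: "x = a * r * b" and r: "r \<in> R" by auto
    have "p * x = (p * a) * r * b" "x * p = a * r * (b * p)" by (simp_all add: x mult.assoc)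
    then have "p * x \<in> ?S" "x * p \<in> ?S" using r by blast+
    then show ?case using step
      by (simp add: distrib_left distrib_right pm_mult_scale_left pm_mult_scale_right
          pm.span_add pm.span_scale pm.span_base)
  qed
  then show ?thesis by (simp add: two_sided_ideal_def ideal_gen_def pm.subspace_span)
qed

lemma ideal_gen_base: "r \<in> R \<Longrightarrow> r \<in> ideal_gen R"
  unfolding ideal_gen_def by (rule pm.span_base, rule CollectI, rule exI[of _ 1], rule exI[of _ r], rule exI[of _ 1]) simp

lemma two_sided_ideal_span:
  assumes "\<And>k r. r \<in> R \<Longrightarrow> single k 1 * r \<in> pm.span R"
    and "\<And>k r. r \<in> R \<Longrightarrow> r * single k 1 \<in> pm.span R"
  shows "two_sided_ideal (pm.span R)"
proof -
  have s: "single k c = pm_scale c (single k 1)" for k :: 'a and c :: 'b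
    by simp
  have 1: "p * r \<in> pm.span R \<and> r * p \<in> pm.span R" if "r \<in> R" for p r
  proof (induction p rule: pm_induct)
    case (single k c)
    then show ?case
      using assms[OF that, of k]
      by (subst (1 2) s) (simp only: pm_mult_scale_left pm_mult_scale_right pm.span_scale)
  qed (simp_all add: pm.span_zero distrib_left distrib_right pm.span_add)
  have "p * q \<in> pm.span R \<and> q * p \<in> pm.span R" if "q \<in> pm.span R" for p q
    using that
  proof (induction rule: pm.span_induct_alt)
    case base
    then show ?case by (simp add: pm.span_zero)
  next
    case (step c x y)
    then show ?case using 1[of x p]
      by (simp add: distrib_left distrib_right pm_mult_scale_left pm_mult_scale_right
          pm.span_add pm.span_scale)
  qed
  then show ?thesis by (simp add: two_sided_ideal_def pm.subspace_span)
qed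

context
  fixes J :: "('k::monoid_add \<Rightarrow>\<^sub>0 'a::field) set"
  assumes J: "two_sided_ideal J"
begin

lemma ideal_sub: "pm.subspace J"
  using J by (simp add: two_sided_ideal_def)

lemma ideal_equivp: "equivp (\<lambda>p q. p - q \<in> J)"
proof (rule equivpI)
  show "reflp (\<lambda>p q. p - q \<in> J)" by (auto intro!: reflpI simp: pm.subspace_0 ideal_sub)
  show "symp (\<lambda>p q. p - q \<in> J)"
    by (rule sympI) (metis ideal_sub minus_diff_eq pm.subspace_neg)
  show "transp (\<lambda>p q. p - q \<in> J)"
  proof (rule transpI)
    fix x y z assume "x - y \<in> J" "y - z \<in> J"
    then have "(x - y) + (y - z) \<in> J" by (intro pm.subspace_add ideal_sub)
    then show "x - z \<in> J" by simp
  qed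
qed

lemma ideal_cong_add: "p - p' \<in> J \<Longrightarrow> q - q' \<in> J \<Longrightarrow> (p + q) - (p' + q') \<in> J"
  using pm.subspace_add[OF ideal_sub, of "p - p'" "q - q'"] by (simp add: algebra_simps)

lemma ideal_cong_diff: "p - p' \<in> J \<Longrightarrow> q - q' \<in> J \<Longrightarrow> (p - q) - (p' - q') \<in> J"
  using pm.subspace_diff[OF ideal_sub, of "p - p'" "q - q'"] by (simp add: algebra_simps)

lemma ideal_cong_uminus: "p - p' \<in> J \<Longrightarrow> (- p) - (- p') \<in> J"
  using pm.subspace_neg[OF ideal_sub, of "p - p'"] by (simp add: algebra_simps)

lemma ideal_cong_scale: "p - p' \<in> J \<Longrightarrow> pm_scale c p - pm_scale c p' \<in> J"
  using pm.subspace_scale[OF ideal_sub, of "p - p'" c] by (simp add: pm.scale_right_diff_distrib)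

lemma ideal_cong_mult:
  assumes "p - p' \<in> J" "q - q' \<in> J"
  shows "p * q - p' * q' \<in> J"
proof -
  have "(p - p') * q + p' * (q - q') \<in> J"
    using assms J by (intro pm.subspace_add ideal_sub) (auto simp: two_sided_ideal_def)
  then show ?thesis by (simp add: algebra_simps)
qed

end


section \<open>Polynomials and divergence-free derivations\<close>

text \<open>
  Variables are indexed by a finite type \<open>'n\<close>; the number of variables is \<open>CARD('n)\<close>.
\<close>

type_synonym ('n, 'a) mpoly = "('n \<Rightarrow>\<^sub>0 nat) \<Rightarrow>\<^sub>0 'a"

definition Var :: "'n \<Rightarrow> ('n, 'a::field) mpoly" where
  "Var i = single (single i 1) 1"

text \<open>
  The partial derivative: the coefficient of \<open>x\<^sup>m\<close> in \<open>D\<^sub>i p\<close> is \<open>m\<^sub>i + 1\<close> times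
  the coefficient of \<open>x\<^sub>i x\<^sup>m\<close> in \<open>p\<close>.
\<close>

lift_definition pd :: "'n \<Rightarrow> ('n, 'a::field) mpoly \<Rightarrow> ('n, 'a) mpoly" is
  "\<lambda>i p m. of_nat (Suc (lookup m i)) * p (m + single i 1)"
proof -
  fix i :: 'n and p :: "('n \<Rightarrow>\<^sub>0 nat) \<Rightarrow> 'a"
  assume "finite {x. p x \<noteq> 0}"
  then have "finite ((\<lambda>m. m + single i 1) -` {x. p x \<noteq> 0})"
    by (rule finite_vimageI) (auto intro: injI)
  then show "finite {m. of_nat (Suc (lookup m i)) * p (m + single i 1) \<noteq> 0}"
    by (rule finite_subset[rotated]) auto
qed

lemma pd_add: "pd i (p + q) = pd i p + pd i q"
  by (rule poly_mapping_eqI) (simp add: pd.rep_eq lookup_add algebra_simps del: of_nat_Suc)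

lemma pd_0 [simp]: "pd i 0 = 0"
  by (rule poly_mapping_eqI) (simp add: pd.rep_eq)

lemma pd_scale: "pd i (pm_scale c p) = pm_scale c (pd i p)"
  by (rule poly_mapping_eqI) (simp add: pd.rep_eq del: of_nat_Suc)

lemma pd_diff: "pd i (p - q) = pd i p - pd i q"
  using pd_add[of i "p - q" q] by simp

lemma pd_uminus: "pd i (- p) = - pd i p"
  using pd_diff[of i 0 p] by simp

lemma pd_sum: "pd i (\<Sum>x\<in>A. f x) = (\<Sum>x\<in>A. pd i (f x))"
  by (induction A rule: infinite_finite_induct) (auto simp: pd_add)

lemma pd_single: "pd i (single m c) = single (m - single i 1) (of_nat (lookup m i) * c)"
proof (rule poly_mapping_eqI)
  fix k
  show "lookup (pd i (single m c)) k = lookup (single (m - single i 1) (of_nat (lookup m i) * c)) k"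
  proof (cases "lookup m i = 0")
    case True
    then have "m \<noteq> k + single i 1" by (auto simp: lookup_add)
    then show ?thesis using True by (simp add: pd.rep_eq lookup_single when_def)
  next
    case False
    then have "m = (m - single i 1) + single i 1"
      by (intro poly_mapping_eqI) (auto simp: lookup_add lookup_minus lookup_single when_def)
    then have *: "m = k + single i 1 \<longleftrightarrow> m - single i 1 = k"
      by (metis add_right_cancel)
    have "Suc (lookup k i) = lookup m i" if "m = k + single i 1"
      by (simp add: that lookup_add)
    then show ?thesis
      using * by (auto simp: pd.rep_eq lookup_single when_def simp del: of_nat_Suc)
  qed
qed

lemma pd_mult: "pd i (p * q) = pd i p * q + p * pd i q"
proof -
  have 1: "pd i (single m c * single l d) = pd i (single m c) * single l d + single m c * pd i (single l d)"
    for m l and c d :: 'b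
  proof -
    have a: "lookup m i \<noteq> 0 \<Longrightarrow> m - single i 1 + l = m + l - single i 1" for m l :: "'a \<Rightarrow>\<^sub>0 nat"
      by (intro poly_mapping_eqI) (auto simp: lookup_add lookup_minus lookup_single when_def)
    have b: "lookup l i \<noteq> 0 \<Longrightarrow> m + (l - single i 1) = m + l - single i 1"
      using a[of l m] by (simp add: add.commute)
    show ?thesis
      using a[of m l] b
      by (cases "lookup m i = 0"; cases "lookup l i = 0")
         (simp_all add: mult_single pd_single lookup_add algebra_simps flip: single_add)
  qed
  have 2: "pd i (single m c * q) = pd i (single m c) * q + single m c * pd i q" for m c
    by (induction q rule: pm_induct) (simp_all add: 1 pd_add algebra_simps)
  show ?thesis
    by (induction p rule: pm_induct) (simp_all add: 2 pd_add distrib_right)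
qed

lemma pd_commute: "pd i (pd j p) = pd j (pd i p)"
  by (cases "i = j")
     (auto intro!: poly_mapping_eqI simp: pd.rep_eq lookup_add lookup_single_not_eq add_ac mult_ac)

lemma pd_Var: "pd i (Var j) = (if i = j then 1 else 0)"
  by (auto simp: Var_def pd_single lookup_single when_def)

lemma pd_numeral [simp]: "pd i (numeral w) = 0"
  by (simp add: pd_single flip: single_numeral)

definition derivation :: "('n::finite \<Rightarrow> ('n, 'a::field) mpoly) \<Rightarrow> ('n, 'a) mpoly \<Rightarrow> ('n, 'a) mpoly" where
  "derivation a p = (\<Sum>i\<in>UNIV. a i * pd i p)"

definition divergence :: "('n::finite \<Rightarrow> ('n, 'a::field) mpoly) \<Rightarrow> ('n, 'a) mpoly" where
  "divergence a = (\<Sum>i\<in>UNIV. pd i (a i))"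

typedef (overloaded) ('n, 'a) splus =
  "{derivation a | a :: 'n::finite \<Rightarrow> ('n, 'a::field) mpoly. divergence a = 0}"
  morphisms act Abs_splus
  by (auto simp: divergence_def intro!: exI[of _ "\<lambda>_. 0"])

setup_lifting type_definition_splus

instantiation splus :: (finite, field) ab_group_add
begin

lift_definition zero_splus :: "('a, 'b) splus" is "\<lambda>_. 0"
  by (auto simp: derivation_def divergence_def fun_eq_iff intro!: exI[of _ "\<lambda>_. 0"])

lift_definition plus_splus :: "('a, 'b) splus \<Rightarrow> ('a, 'b) splus \<Rightarrow> ('a, 'b) splus" is
  "\<lambda>X Y p. X p + Y p"
proof clarify
  fix a b :: "'a \<Rightarrow> ('a, 'b) mpoly"
  assume "divergence a = 0" "divergence b = 0"
  then show "\<exists>c. (\<lambda>p. derivation a p + derivation b p) = derivation c \<and> divergence c = 0"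
    by (intro exI[of _ "\<lambda>i. a i + b i"])
       (simp add: derivation_def divergence_def pd_add sum.distrib algebra_simps fun_eq_iff)
qed

lift_definition uminus_splus :: "('a, 'b) splus \<Rightarrow> ('a, 'b) splus" is "\<lambda>X p. - X p"
proof clarify
  fix a :: "'a \<Rightarrow> ('a, 'b) mpoly"
  assume "divergence a = 0"
  then show "\<exists>c. (\<lambda>p. - derivation a p) = derivation c \<and> divergence c = 0"
    by (intro exI[of _ "\<lambda>i. - a i"])
       (simp add: derivation_def divergence_def pd_uminus sum_negf fun_eq_iff)
qed

definition minus_splus :: "('a, 'b) splus \<Rightarrow> ('a, 'b) splus \<Rightarrow> ('a, 'b) splus" where
  "minus_splus X Y = X + - Y"

instance
proof
  fix X Y Z :: "('a, 'b) splus"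
  show "X + Y + Z = X + (Y + Z)" "X + Y = Y + X" "0 + X = X" "- X + X = 0"
    by (simp_all add: plus_splus.rep_eq uminus_splus.rep_eq zero_splus.rep_eq add_ac
        flip: act_inject)
  show "X - Y = X + - Y" by (fact minus_splus_def)
qed

end

lift_definition splus_scale :: "'a::field \<Rightarrow> ('n::finite, 'a) splus \<Rightarrow> ('n, 'a) splus" is
  "\<lambda>c X p. pm_scale c (X p)"
proof clarify
  fix c and a :: "'n \<Rightarrow> ('n, 'a) mpoly"
  assume "divergence a = 0"
  then show "\<exists>b. (\<lambda>p. pm_scale c (derivation a p)) = derivation b \<and> divergence b = 0"
    by (intro exI[of _ "\<lambda>i. pm_scale c (a i)"])
       (simp add: derivation_def divergence_def pd_scale pm_mult_scale_left fun_eq_iff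
          flip: pm.scale_sum_right)
qed

lemma derivation_add: "derivation a (p + q) = derivation a p + derivation a q"
  by (simp add: derivation_def pd_add algebra_simps sum.distrib)

lemma derivation_bracket:
  "derivation a (derivation b p) - derivation b (derivation a p)
    = derivation (\<lambda>j. derivation a (b j) - derivation b (a j)) p"
proof -
  have 1: "derivation a (derivation b p) =
      derivation (\<lambda>j. derivation a (b j)) p + (\<Sum>i\<in>UNIV. \<Sum>j\<in>UNIV. a i * b j * pd i (pd j p))"
    for a b :: "'a \<Rightarrow> ('a, 'b) mpoly"
  proof -
    have "derivation a (derivation b p)
      = (\<Sum>i\<in>UNIV. \<Sum>j\<in>UNIV. a i * pd i (b j) * pd j p + a i * b j * pd i (pd j p))"
      by (simp add: derivation_def pd_sum pd_mult sum_distrib_left algebra_simps)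
    also have "(\<Sum>i\<in>UNIV. \<Sum>j\<in>UNIV. a i * pd i (b j) * pd j p) = derivation (\<lambda>j. derivation a (b j)) p"
      by (subst sum.swap) (simp add: derivation_def sum_distrib_right)
    ultimately show ?thesis by (simp add: sum.distrib derivation_def)
  qed
  have "(\<Sum>i\<in>UNIV. \<Sum>j\<in>UNIV. a i * b j * pd i (pd j p)) = (\<Sum>i\<in>UNIV. \<Sum>j\<in>UNIV. b i * a j * pd i (pd j p))"
    by (subst sum.swap) (simp add: pd_commute[of _ _ p] mult.commute)
  then show ?thesis
    unfolding 1[of a b] 1[of b a]
    by (simp add: derivation_def algebra_simps sum_subtractf)
qed

lemma divergence_bracket:
  assumes "divergence a = 0" "divergence b = 0"
  shows "divergence (\<lambda>j. derivation a (b j) - derivation b (a j)) = 0"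
proof -
  have 1: "(\<Sum>j\<in>UNIV. pd j (derivation a (b j))) = (\<Sum>j\<in>UNIV. \<Sum>i\<in>UNIV. pd j (a i) * pd i (b j))"
    if "divergence b = 0" for a b :: "'a \<Rightarrow> ('a, 'b) mpoly"
  proof -
    have "(\<Sum>j\<in>UNIV. \<Sum>i\<in>UNIV. a i * pd j (pd i (b j))) = (\<Sum>i\<in>UNIV. a i * pd i (divergence b))"
      by (subst sum.swap) (simp add: divergence_def pd_sum sum_distrib_left pd_commute)
    then have "(\<Sum>j\<in>UNIV. \<Sum>i\<in>UNIV. a i * pd j (pd i (b j))) = 0" by (simp add: that)
    then show ?thesis by (simp add: derivation_def pd_sum pd_mult sum.distrib)
  qed
  have "(\<Sum>j\<in>UNIV. \<Sum>i\<in>UNIV. pd j (a i) * pd i (b j)) = (\<Sum>j\<in>UNIV. \<Sum>i\<in>UNIV. pd j (b i) * pd i (a j))"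
    by (subst sum.swap) (simp add: mult.commute)
  then show ?thesis
    by (simp add: divergence_def[of "\<lambda>j. derivation a (b j) - derivation b (a j)"]
        pd_diff sum_subtractf 1 assms)
qed

lift_definition splus_bracket :: "('n::finite, 'a::field) splus \<Rightarrow> ('n, 'a) splus \<Rightarrow> ('n, 'a) splus" is
  "\<lambda>X Y p. X (Y p) - Y (X p)"
proof clarify
  fix a b :: "'n \<Rightarrow> ('n, 'a) mpoly"
  assume "divergence a = 0" "divergence b = 0"
  then show "\<exists>c. (\<lambda>p. derivation a (derivation b p) - derivation b (derivation a p)) = derivation c
      \<and> divergence c = 0"
    by (intro exI[of _ "\<lambda>j. derivation a (b j) - derivation b (a j)"])
       (simp add: derivation_bracket divergence_bracket fun_eq_iff)
qed

definition euler :: "'n \<Rightarrow> ('n, 'a::field) mpoly \<Rightarrow> ('n, 'a) mpoly" where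
  "euler i p = Var i * pd i p"

text \<open>
  \<open>h_elt i j\<close> and (for \<open>i \<noteq> j\<close>) \<open>e_elt i j\<close> are the elements \<open>h(i,j)\<close> and \<open>e(i,j)\<close>; the lemmas
  \<open>act_h_elt\<close> and \<open>act_e_elt\<close> show that these derivations do have divergence zero.
\<close>

definition h_elt :: "'n::finite \<Rightarrow> 'n \<Rightarrow> ('n, 'a::field) splus" where
  "h_elt i j = Abs_splus (\<lambda>p. euler i p - euler j p)"

definition e_elt :: "'n::finite \<Rightarrow> 'n \<Rightarrow> ('n, 'a::field) splus" where
  "e_elt i j = Abs_splus (\<lambda>p. Var i * (euler i p - 2 * euler j p))"

lemma act_h_elt: "act (h_elt i j) = (\<lambda>p. euler i p - euler j p)"
proof -
  define a :: "'a \<Rightarrow> ('a, 'b) mpoly"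
    where "a k = (if k = i then Var i else 0) - (if k = j then Var j else 0)" for k
  have *: "(\<Sum>k\<in>UNIV. g k * (if k = l then v else 0)) = g l * v" for l v and g :: "'a \<Rightarrow> ('a, 'b) mpoly"
    by (simp add: if_distrib cong: if_cong)
  have "(\<lambda>p. euler i p - euler j p) = derivation a"
    by (rule ext)
       (simp add: derivation_def a_def euler_def right_diff_distrib sum_subtractf * mult.commute[of _ "pd _ _"])
  moreover have "pd k (a k) = (if k = i then 1 else 0) - (if k = j then 1 else 0)" for k
    by (simp add: a_def pd_diff pd_Var)
  then have "divergence a = 0"
    by (simp add: divergence_def sum_subtractf)
  ultimately have "(\<lambda>p. euler i p - euler j p) \<in> {derivation a | a :: 'a \<Rightarrow> ('a, 'b) mpoly. divergence a = 0}"
    by blast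
  then show ?thesis by (simp add: h_elt_def Abs_splus_inverse)
qed

lemma act_e_elt:
  assumes "i \<noteq> j"
  shows "act (e_elt i j) = (\<lambda>p. Var i * (euler i p - 2 * euler j p))"
proof -
  define a :: "'a \<Rightarrow> ('a, 'b) mpoly"
    where "a k = (if k = i then Var i * Var i else 0) - (if k = j then 2 * Var i * Var j else 0)" for k
  have *: "(\<Sum>k\<in>UNIV. g k * (if k = l then v else 0)) = g l * v" for l v and g :: "'a \<Rightarrow> ('a, 'b) mpoly"
    by (simp add: if_distrib cong: if_cong)
  have "(\<lambda>p. Var i * (euler i p - 2 * euler j p)) = derivation a"
    by (rule ext)
       (simp add: derivation_def a_def euler_def left_diff_distrib right_diff_distrib sum_subtractf * algebra_simps)
  moreover have "pd k (a k) = (if k = i then 2 * Var i else 0) - (if k = j then 2 * Var i else 0)" for k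
    using assms by (simp add: a_def pd_diff pd_mult pd_Var)
  then have "divergence a = 0"
    by (simp add: divergence_def sum_subtractf)
  ultimately have "(\<lambda>p. Var i * (euler i p - 2 * euler j p))
      \<in> {derivation a | a :: 'a \<Rightarrow> ('a, 'b) mpoly. divergence a = 0}"
    by blast
  then show ?thesis by (simp add: e_elt_def Abs_splus_inverse)
qed

lemma splus_bracket_h_e:
  assumes "i \<noteq> j"
  shows "splus_bracket (h_elt i j) (e_elt i j) = (e_elt i j :: ('a::finite, 'b::field) splus)"
proof -
  have comm: "euler k (euler l p) = euler l (euler k p)" for k l and p :: "('a, 'b) mpoly"
    by (cases "k = l") (simp_all add: euler_def pd_mult pd_Var pd_commute[of k l] mult.left_commute)
  have a: "euler j (Var i * q) = Var i * euler j q" "euler i (Var i * q) = Var i * q + Var i * euler i q"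
    for q :: "('a, 'b) mpoly"
    using assms by (simp_all add: euler_def pd_mult pd_Var algebra_simps)
  have b: "euler k (p - q) = euler k p - euler k q" "euler k (2 * p) = 2 * euler k p"
    for k and p q :: "('a, 'b) mpoly"
    by (simp_all add: euler_def pd_diff pd_mult algebra_simps)
  have "act (splus_bracket (h_elt i j) (e_elt i j)) p = act (e_elt i j) p"
    for p :: "('a, 'b) mpoly"
    by (simp only: splus_bracket.rep_eq act_h_elt act_e_elt[OF assms] a b comm[of j i])
       (simp add: algebra_simps)
  then show ?thesis by (simp add: fun_eq_iff flip: act_inject)
qed


section \<open>The universal enveloping algebra\<close>

text \<open>
  Words over \<open>'l\<close> form the free monoid, so \<open>'l word \<Rightarrow>\<^sub>0 'a\<close> is the free associative algebra.
  The universal enveloping algebra is its quotient by the linear relations of the Lie algebra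
  (which cut it down to the tensor algebra) and the relations \<open>xy - yx = [x,y]\<close>.
\<close>

datatype 'l word = Word (letters: "'l list")

instantiation word :: (type) monoid_add
begin

definition zero_word :: "'a word" where "zero_word = Word []"

definition plus_word :: "'a word \<Rightarrow> 'a word \<Rightarrow> 'a word" where
  "plus_word v w = Word (letters v @ letters w)"

instance by standard (simp_all add: zero_word_def plus_word_def)

end

definition letter :: "'l \<Rightarrow> 'l word \<Rightarrow>\<^sub>0 'a::field" where
  "letter x = single (Word [x]) 1"

inductive_set env_relations ::
    "('a::field \<Rightarrow> 'l::ab_group_add \<Rightarrow> 'l) \<Rightarrow> ('l \<Rightarrow> 'l \<Rightarrow> 'l) \<Rightarrow> ('l word \<Rightarrow>\<^sub>0 'a) set"
  for sc :: "'a \<Rightarrow> 'l \<Rightarrow> 'l" and br :: "'l \<Rightarrow> 'l \<Rightarrow> 'l" where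
  add: "letter (x + y) - letter x - letter y \<in> env_relations sc br"
| scale: "letter (sc c x) - pm_scale c (letter x) \<in> env_relations sc br"
| bracket: "letter x * letter y - letter y * letter x - letter (br x y) \<in> env_relations sc br"

definition env_ideal :: "(('n::finite, 'a::field) splus word \<Rightarrow>\<^sub>0 'a) set" where
  "env_ideal = ideal_gen (env_relations splus_scale splus_bracket)"

lemma env_ideal: "two_sided_ideal env_ideal"
  unfolding env_ideal_def by (rule two_sided_ideal_ideal_gen)

lemma lin_ext_ideal_gen_eq_0:
  fixes sc :: "'a::field \<Rightarrow> 'v::ring \<Rightarrow> 'v" and f :: "'k::monoid_add \<Rightarrow> 'v"
  assumes "vector_space sc"
    and "\<And>c u v. sc c u * v = sc c (u * v)" "\<And>c u v. u * sc c v = sc c (u * v)"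
    and "\<And>k l. f (k + l) = f k * f l"
    and R: "\<And>r. r \<in> R \<Longrightarrow> lin_ext sc f r = 0" and p: "p \<in> ideal_gen R"
  shows "lin_ext sc f p = 0"
proof -
  interpret vector_space sc by fact
  show ?thesis
    by (rule lin_ext_span_eq_0[OF _ p[unfolded ideal_gen_def]])
       (auto simp: lin_ext_mult[of sc f, OF assms(1-4)] R)
qed

quotient_type (overloaded) ('n, 'a) usplus =
  "('n::finite, 'a::field) splus word \<Rightarrow>\<^sub>0 'a" / "\<lambda>p q. p - q \<in> env_ideal"
  by (rule ideal_equivp[OF env_ideal])

lemma field_vector_space: "vector_space ((*) :: 'a::field \<Rightarrow> 'a \<Rightarrow> 'a)"
  by unfold_locales (simp_all add: algebra_simps)

global_interpretation fld: vector_space "(*) :: 'a::field \<Rightarrow> 'a \<Rightarrow> 'a"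
  by (rule field_vector_space)

definition counit_word :: "'l word \<Rightarrow> 'a::field" where
  "counit_word w = (if letters w = [] then 1 else 0)"

lemma counit_env_ideal:
  assumes "p \<in> (env_ideal :: (('n::finite, 'a::field) splus word \<Rightarrow>\<^sub>0 'a) set)"
  shows "lin_ext (*) counit_word p = 0"
  by (rule lin_ext_ideal_gen_eq_0[OF field_vector_space _ _ _ _ assms[unfolded env_ideal_def]])
     (auto elim!: env_relations.cases simp: counit_word_def plus_word_def letter_def fld.lin_ext_minus
        pm_scale_single mult_single)

lift_definition usplus_counit :: "('n::finite, 'a::field) usplus \<Rightarrow> 'a" is "lin_ext (*) counit_word"
  using counit_env_ideal fld.lin_ext_minus by (metis eq_iff_diff_eq_0)

instantiation usplus :: (finite, field) ring_1
begin

lift_definition zero_usplus :: "('a, 'b) usplus" is 0 .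
lift_definition one_usplus :: "('a, 'b) usplus" is 1 .
lift_definition plus_usplus :: "('a, 'b) usplus \<Rightarrow> ('a, 'b) usplus \<Rightarrow> ('a, 'b) usplus" is "(+)"
  by (rule ideal_cong_add[OF env_ideal])
lift_definition minus_usplus :: "('a, 'b) usplus \<Rightarrow> ('a, 'b) usplus \<Rightarrow> ('a, 'b) usplus" is "(-)"
  by (rule ideal_cong_diff[OF env_ideal])
lift_definition uminus_usplus :: "('a, 'b) usplus \<Rightarrow> ('a, 'b) usplus" is uminus
  by (rule ideal_cong_uminus[OF env_ideal])
lift_definition times_usplus :: "('a, 'b) usplus \<Rightarrow> ('a, 'b) usplus \<Rightarrow> ('a, 'b) usplus" is "(*)"
  by (rule ideal_cong_mult[OF env_ideal])

instance
proof
  show "(0 :: ('a, 'b) usplus) \<noteq> 1"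
  proof
    assume "(0 :: ('a, 'b) usplus) = 1"
    then have "usplus_counit (0 :: ('a, 'b) usplus) = usplus_counit 1" by simp
    then show False
      by transfer (simp add: fld.lin_ext_single[of _ 0 1, simplified] counit_word_def zero_word_def)
  qed
qed (transfer; simp add: algebra_simps pm.subspace_0[OF ideal_sub[OF env_ideal]])+

end

lift_definition usplus_scale :: "'a \<Rightarrow> ('n::finite, 'a::field) usplus \<Rightarrow> ('n, 'a) usplus" is pm_scale
  by (rule ideal_cong_scale[OF env_ideal])

lifting_forget splus.lifting

lift_definition incl :: "('n::finite, 'a::field) splus \<Rightarrow> ('n, 'a) usplus" is letter .

lemma usplus_vector_space: "vector_space (usplus_scale :: 'a \<Rightarrow> ('n::finite, 'a::field) usplus \<Rightarrow> _)"
  by unfold_locales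
     (transfer; simp add: pm.scale_right_distrib pm.scale_left_distrib
        pm.subspace_0[OF ideal_sub[OF env_ideal]])+

global_interpretation usp: vector_space "usplus_scale :: 'a \<Rightarrow> ('n::finite, 'a::field) usplus \<Rightarrow> _"
  by (rule usplus_vector_space)

lemma usplus_scale_mult_left: "usplus_scale c u * v = usplus_scale c (u * v)"
  by transfer (simp add: pm_mult_scale_left pm.subspace_0[OF ideal_sub[OF env_ideal]])

lemma usplus_scale_mult_right: "u * usplus_scale c v = usplus_scale c (u * v)"
  by transfer (simp add: pm_mult_scale_right pm.subspace_0[OF ideal_sub[OF env_ideal]])

lemma incl_add: "incl (x + y) = incl x + incl y"
  by transfer
     (simp only: env_ideal_def diff_diff_add[symmetric], intro ideal_gen_base env_relations.intros)

lemma incl_scale: "incl (splus_scale c x) = usplus_scale c (incl x)"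
  by transfer (unfold env_ideal_def, intro ideal_gen_base env_relations.intros)

lemma incl_bracket: "incl (splus_bracket x y) = incl x * incl y - incl y * incl x"
proof -
  have "incl x * incl y - incl y * incl x = incl (splus_bracket x y)"
    by transfer (unfold env_ideal_def, intro ideal_gen_base env_relations.intros)
  then show ?thesis by simp
qed

lemma usplus_counit_add: "usplus_counit (u + v) = usplus_counit u + usplus_counit v"
  by transfer (rule fld.lin_ext_add)

lemma usplus_counit_scale: "usplus_counit (usplus_scale c u) = c * usplus_counit u"
  by transfer (rule fld.lin_ext_scale)

lemma usplus_counit_1 [simp]: "usplus_counit 1 = 1"
  by transfer (simp add: fld.lin_ext_single[of _ 0 1, simplified] counit_word_def zero_word_def)


section \<open>Tensor powers of an algebra\<close>

text \<open>
  \<open>Pure2 u v\<close> and \<open>Pure3 u v w\<close> index the basis of the free vector space of which the two- and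
  threefold tensor products are quotients. They are monoids under componentwise
  multiplication (written additively), so these free vector spaces are algebras and the product
  induced on the quotients is \<open>(u \<otimes> v) (u' \<otimes> v') = uu' \<otimes> vv'\<close>.
\<close>

datatype 'u pure2 = Pure2 'u 'u
datatype 'u pure3 = Pure3 'u 'u 'u

instantiation pure2 :: (monoid_mult) monoid_add
begin

definition zero_pure2 :: "'a pure2" where "zero_pure2 = Pure2 1 1"

fun plus_pure2 :: "'a pure2 \<Rightarrow> 'a pure2 \<Rightarrow> 'a pure2" where
  "plus_pure2 (Pure2 u v) (Pure2 u' v') = Pure2 (u * u') (v * v')"

instance
proof
  fix a b c :: "'a pure2"
  show "a + b + c = a + (b + c)" by (cases a; cases b; cases c) (simp add: mult.assoc)
  show "0 + a = a" "a + 0 = a" by (cases a; simp add: zero_pure2_def)+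
qed

end

instantiation pure3 :: (monoid_mult) monoid_add
begin

definition zero_pure3 :: "'a pure3" where "zero_pure3 = Pure3 1 1 1"

fun plus_pure3 :: "'a pure3 \<Rightarrow> 'a pure3 \<Rightarrow> 'a pure3" where
  "plus_pure3 (Pure3 u v w) (Pure3 u' v' w') = Pure3 (u * u') (v * v') (w * w')"

instance
proof
  fix a b c :: "'a pure3"
  show "a + b + c = a + (b + c)" by (cases a; cases b; cases c) (simp add: mult.assoc)
  show "0 + a = a" "a + 0 = a" by (cases a; simp add: zero_pure3_def)+
qed

end

inductive_set tensor2_relations :: "('a::field \<Rightarrow> 'u::ring_1 \<Rightarrow> 'u) \<Rightarrow> ('u pure2 \<Rightarrow>\<^sub>0 'a) set"
  for sc :: "'a \<Rightarrow> 'u \<Rightarrow> 'u" where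
  add1: "single (Pure2 (u + u') v) 1 - single (Pure2 u v) 1 - single (Pure2 u' v) 1 \<in> tensor2_relations sc"
| add2: "single (Pure2 u (v + v')) 1 - single (Pure2 u v) 1 - single (Pure2 u v') 1 \<in> tensor2_relations sc"
| scale1: "single (Pure2 (sc c u) v) 1 - single (Pure2 u v) c \<in> tensor2_relations sc"
| scale2: "single (Pure2 u (sc c v)) 1 - single (Pure2 u v) c \<in> tensor2_relations sc"

inductive_set tensor3_relations :: "('a::field \<Rightarrow> 'u::ring_1 \<Rightarrow> 'u) \<Rightarrow> ('u pure3 \<Rightarrow>\<^sub>0 'a) set"
  for sc :: "'a \<Rightarrow> 'u \<Rightarrow> 'u" where
  add1: "single (Pure3 (u + u') v w) 1 - single (Pure3 u v w) 1 - single (Pure3 u' v w) 1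
    \<in> tensor3_relations sc"
| add2: "single (Pure3 u (v + v') w) 1 - single (Pure3 u v w) 1 - single (Pure3 u v' w) 1
    \<in> tensor3_relations sc"
| add3: "single (Pure3 u v (w + w')) 1 - single (Pure3 u v w) 1 - single (Pure3 u v w') 1
    \<in> tensor3_relations sc"
| scale1: "single (Pure3 (sc c u) v w) 1 - single (Pure3 u v w) c \<in> tensor3_relations sc"
| scale2: "single (Pure3 u (sc c v) w) 1 - single (Pure3 u v w) c \<in> tensor3_relations sc"
| scale3: "single (Pure3 u v (sc c w)) 1 - single (Pure3 u v w) c \<in> tensor3_relations sc"

lemma tensor2_ideal:
  fixes sc :: "'a::field \<Rightarrow> 'u::ring_1 \<Rightarrow> 'u"
  assumes "\<And>c u v. sc c u * v = sc c (u * v)" "\<And>c u v. u * sc c v = sc c (u * v)"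
  shows "two_sided_ideal (pm.span (tensor2_relations sc))"
proof (rule two_sided_ideal_span; rule pm.span_base)
  fix k :: "'u pure2" and r assume r: "r \<in> tensor2_relations sc"
  obtain x y where k: "k = Pure2 x y" by (cases k)
  show "single k 1 * r \<in> tensor2_relations sc" "r * single k 1 \<in> tensor2_relations sc"
    using r unfolding k
    by (cases; simp add: left_diff_distrib right_diff_distrib mult_single
        distrib_left distrib_right assms tensor2_relations.intros)+
qed

lemma tensor3_ideal:
  fixes sc :: "'a::field \<Rightarrow> 'u::ring_1 \<Rightarrow> 'u"
  assumes "\<And>c u v. sc c u * v = sc c (u * v)" "\<And>c u v. u * sc c v = sc c (u * v)"
  shows "two_sided_ideal (pm.span (tensor3_relations sc))"
proof (rule two_sided_ideal_span; rule pm.span_base)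
  fix k :: "'u pure3" and r assume r: "r \<in> tensor3_relations sc"
  obtain x y z where k: "k = Pure3 x y z" by (cases k)
  show "single k 1 * r \<in> tensor3_relations sc" "r * single k 1 \<in> tensor3_relations sc"
    using r unfolding k
    by (cases; simp add: left_diff_distrib right_diff_distrib mult_single
        distrib_left distrib_right assms tensor3_relations.intros)+
qed

definition ten2_ideal :: "(('n::finite, 'a::field) usplus pure2 \<Rightarrow>\<^sub>0 'a) set" where
  "ten2_ideal = pm.span (tensor2_relations usplus_scale)"

definition ten3_ideal :: "(('n::finite, 'a::field) usplus pure3 \<Rightarrow>\<^sub>0 'a) set" where
  "ten3_ideal = pm.span (tensor3_relations usplus_scale)"

lemma ten2_ideal: "two_sided_ideal ten2_ideal"
  unfolding ten2_ideal_def
  by (rule tensor2_ideal) (rule usplus_scale_mult_left usplus_scale_mult_right)+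

lemma ten3_ideal: "two_sided_ideal ten3_ideal"
  unfolding ten3_ideal_def
  by (rule tensor3_ideal) (rule usplus_scale_mult_left usplus_scale_mult_right)+

quotient_type (overloaded) ('n, 'a) usplus2 =
  "('n::finite, 'a::field) usplus pure2 \<Rightarrow>\<^sub>0 'a" / "\<lambda>p q. p - q \<in> ten2_ideal"
  by (rule ideal_equivp[OF ten2_ideal])

quotient_type (overloaded) ('n, 'a) usplus3 =
  "('n::finite, 'a::field) usplus pure3 \<Rightarrow>\<^sub>0 'a" / "\<lambda>p q. p - q \<in> ten3_ideal"
  by (rule ideal_equivp[OF ten3_ideal])

lemma (in vector_space) lin_ext_tensor2:
  fixes sc :: "'a \<Rightarrow> 'u::ring_1 \<Rightarrow> 'u"
  assumes p: "p - q \<in> pm.span (tensor2_relations sc)"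
    and "\<And>u u' v. f (u + u') v = f u v + f u' v" "\<And>u v v'. f u (v + v') = f u v + f u v'"
    and "\<And>c u v. f (sc c u) v = scale c (f u v)" "\<And>c u v. f u (sc c v) = scale c (f u v)"
  shows "lin_ext scale (case_pure2 f) p = lin_ext scale (case_pure2 f) q"
proof -
  have "lin_ext scale (case_pure2 f) (p - q) = 0"
    by (rule lin_ext_span_eq_0[OF _ p]) (auto elim!: tensor2_relations.cases simp: lin_ext_minus assms(2-))
  then show ?thesis by (simp add: lin_ext_minus)
qed

lemma (in vector_space) lin_ext_tensor3:
  fixes sc :: "'a \<Rightarrow> 'u::ring_1 \<Rightarrow> 'u"
  assumes p: "p - q \<in> pm.span (tensor3_relations sc)"
    and "\<And>u u' v w. f (u + u') v w = f u v w + f u' v w"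
    and "\<And>u v v' w. f u (v + v') w = f u v w + f u v' w"
    and "\<And>u v w w'. f u v (w + w') = f u v w + f u v w'"
    and "\<And>c u v w. f (sc c u) v w = scale c (f u v w)" "\<And>c u v w. f u (sc c v) w = scale c (f u v w)"
    and "\<And>c u v w. f u v (sc c w) = scale c (f u v w)"
  shows "lin_ext scale (case_pure3 f) p = lin_ext scale (case_pure3 f) q"
proof -
  have "lin_ext scale (case_pure3 f) (p - q) = 0"
    by (rule lin_ext_span_eq_0[OF _ p]) (auto elim!: tensor3_relations.cases simp: lin_ext_minus assms(2-))
  then show ?thesis by (simp add: lin_ext_minus)
qed

lemma ten2_nontrivial: "1 \<notin> (ten2_ideal :: (('n::finite, 'a::field) usplus pure2 \<Rightarrow>\<^sub>0 'a) set)"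
proof
  assume *: "1 \<in> (ten2_ideal :: (('n, 'a) usplus pure2 \<Rightarrow>\<^sub>0 'a) set)"
  let ?f = "(\<lambda>u v. usplus_counit u * usplus_counit v) :: ('n, 'a) usplus \<Rightarrow> _"
  have one: "single (Pure2 1 1) 1 = (1 :: ('n, 'a) usplus pure2 \<Rightarrow>\<^sub>0 'a)"
    by (simp only: zero_pure2_def[symmetric] single_one)
  have "single (Pure2 1 1) 1 - 0 \<in> pm.span (tensor2_relations (usplus_scale :: 'a \<Rightarrow> ('n, 'a) usplus \<Rightarrow> _))"
    using * by (simp only: one ten2_ideal_def diff_0_right)
  then have "lin_ext (*) (case_pure2 ?f) (single (Pure2 1 1) 1) = lin_ext (*) (case_pure2 ?f) 0"
    by (rule fld.lin_ext_tensor2)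
       (simp_all only: usplus_counit_add usplus_counit_scale distrib_left distrib_right mult.assoc
          mult.left_commute)
  then show False by simp
qed

lemma ten3_nontrivial: "1 \<notin> (ten3_ideal :: (('n::finite, 'a::field) usplus pure3 \<Rightarrow>\<^sub>0 'a) set)"
proof
  assume *: "1 \<in> (ten3_ideal :: (('n, 'a) usplus pure3 \<Rightarrow>\<^sub>0 'a) set)"
  let ?f = "(\<lambda>u v w. usplus_counit u * usplus_counit v * usplus_counit w) :: ('n, 'a) usplus \<Rightarrow> _"
  have one: "single (Pure3 1 1 1) 1 = (1 :: ('n, 'a) usplus pure3 \<Rightarrow>\<^sub>0 'a)"
    by (simp only: zero_pure3_def[symmetric] single_one)
  have "single (Pure3 1 1 1) 1 - 0 \<in> pm.span (tensor3_relations (usplus_scale :: 'a \<Rightarrow> ('n, 'a) usplus \<Rightarrow> _))"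
    using * by (simp only: one ten3_ideal_def diff_0_right)
  then have "lin_ext (*) (case_pure3 ?f) (single (Pure3 1 1 1) 1) = lin_ext (*) (case_pure3 ?f) 0"
    by (rule fld.lin_ext_tensor3)
       (simp_all only: usplus_counit_add usplus_counit_scale distrib_left distrib_right mult.assoc
          mult.left_commute)
  then show False by simp
qed

instantiation usplus2 :: (finite, field) ring_1
begin

lift_definition zero_usplus2 :: "('a, 'b) usplus2" is 0 .
lift_definition one_usplus2 :: "('a, 'b) usplus2" is 1 .
lift_definition plus_usplus2 :: "('a, 'b) usplus2 \<Rightarrow> ('a, 'b) usplus2 \<Rightarrow> ('a, 'b) usplus2" is "(+)"
  by (rule ideal_cong_add[OF ten2_ideal])
lift_definition minus_usplus2 :: "('a, 'b) usplus2 \<Rightarrow> ('a, 'b) usplus2 \<Rightarrow> ('a, 'b) usplus2" is "(-)"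
  by (rule ideal_cong_diff[OF ten2_ideal])
lift_definition uminus_usplus2 :: "('a, 'b) usplus2 \<Rightarrow> ('a, 'b) usplus2" is uminus
  by (rule ideal_cong_uminus[OF ten2_ideal])
lift_definition times_usplus2 :: "('a, 'b) usplus2 \<Rightarrow> ('a, 'b) usplus2 \<Rightarrow> ('a, 'b) usplus2" is "(*)"
  by (rule ideal_cong_mult[OF ten2_ideal])

instance
proof
  show "(0 :: ('a, 'b) usplus2) \<noteq> 1"
    by transfer (use ten2_nontrivial pm.subspace_neg[OF ideal_sub[OF ten2_ideal], of "- 1"] in auto)
qed (transfer; simp add: algebra_simps pm.subspace_0[OF ideal_sub[OF ten2_ideal]])+

end

instantiation usplus3 :: (finite, field) ring_1
begin

lift_definition zero_usplus3 :: "('a, 'b) usplus3" is 0 .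
lift_definition one_usplus3 :: "('a, 'b) usplus3" is 1 .
lift_definition plus_usplus3 :: "('a, 'b) usplus3 \<Rightarrow> ('a, 'b) usplus3 \<Rightarrow> ('a, 'b) usplus3" is "(+)"
  by (rule ideal_cong_add[OF ten3_ideal])
lift_definition minus_usplus3 :: "('a, 'b) usplus3 \<Rightarrow> ('a, 'b) usplus3 \<Rightarrow> ('a, 'b) usplus3" is "(-)"
  by (rule ideal_cong_diff[OF ten3_ideal])
lift_definition uminus_usplus3 :: "('a, 'b) usplus3 \<Rightarrow> ('a, 'b) usplus3" is uminus
  by (rule ideal_cong_uminus[OF ten3_ideal])
lift_definition times_usplus3 :: "('a, 'b) usplus3 \<Rightarrow> ('a, 'b) usplus3 \<Rightarrow> ('a, 'b) usplus3" is "(*)"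
  by (rule ideal_cong_mult[OF ten3_ideal])

instance
proof
  show "(0 :: ('a, 'b) usplus3) \<noteq> 1"
    by transfer (use ten3_nontrivial pm.subspace_neg[OF ideal_sub[OF ten3_ideal], of "- 1"] in auto)
qed (transfer; simp add: algebra_simps pm.subspace_0[OF ideal_sub[OF ten3_ideal]])+

end

lift_definition usplus2_scale :: "'a \<Rightarrow> ('n::finite, 'a::field) usplus2 \<Rightarrow> ('n, 'a) usplus2" is pm_scale
  by (rule ideal_cong_scale[OF ten2_ideal])

lift_definition usplus3_scale :: "'a \<Rightarrow> ('n::finite, 'a::field) usplus3 \<Rightarrow> ('n, 'a) usplus3" is pm_scale
  by (rule ideal_cong_scale[OF ten3_ideal])

lemma usplus2_vector_space: "vector_space (usplus2_scale :: 'a \<Rightarrow> ('n::finite, 'a::field) usplus2 \<Rightarrow> _)"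
  by unfold_locales
     (transfer; simp add: pm.scale_right_distrib pm.scale_left_distrib
        pm.subspace_0[OF ideal_sub[OF ten2_ideal]])+

lemma usplus3_vector_space: "vector_space (usplus3_scale :: 'a \<Rightarrow> ('n::finite, 'a::field) usplus3 \<Rightarrow> _)"
  by unfold_locales
     (transfer; simp add: pm.scale_right_distrib pm.scale_left_distrib
        pm.subspace_0[OF ideal_sub[OF ten3_ideal]])+

global_interpretation usp2: vector_space "usplus2_scale :: 'a \<Rightarrow> ('n::finite, 'a::field) usplus2 \<Rightarrow> _"
  by (rule usplus2_vector_space)

global_interpretation usp3: vector_space "usplus3_scale :: 'a \<Rightarrow> ('n::finite, 'a::field) usplus3 \<Rightarrow> _"
  by (rule usplus3_vector_space)

lemma usplus2_scale_mult_left: "usplus2_scale c u * v = usplus2_scale c (u * v)"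
  by transfer (simp add: pm_mult_scale_left pm.subspace_0[OF ideal_sub[OF ten2_ideal]])

lemma usplus2_scale_mult_right: "u * usplus2_scale c v = usplus2_scale c (u * v)"
  by transfer (simp add: pm_mult_scale_right pm.subspace_0[OF ideal_sub[OF ten2_ideal]])

lifting_forget usplus.lifting

lift_definition tensor2 :: "('n::finite, 'a::field) usplus \<Rightarrow> ('n, 'a) usplus \<Rightarrow> ('n, 'a) usplus2"
  (infixl \<open>\<otimes>\<^sub>2\<close> 71) is "\<lambda>u v. single (Pure2 u v) 1" .

lift_definition tensor3 ::
  "('n::finite, 'a::field) usplus \<Rightarrow> ('n, 'a) usplus \<Rightarrow> ('n, 'a) usplus \<Rightarrow> ('n, 'a) usplus3"
  is "\<lambda>u v w. single (Pure3 u v w) 1" .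

lemma tensor2_bilinear:
  "(u + u') \<otimes>\<^sub>2 v = u \<otimes>\<^sub>2 v + u' \<otimes>\<^sub>2 v" "u \<otimes>\<^sub>2 (v + v') = u \<otimes>\<^sub>2 v + u \<otimes>\<^sub>2 v'"
  "usplus_scale c u \<otimes>\<^sub>2 v = usplus2_scale c (u \<otimes>\<^sub>2 v)" "u \<otimes>\<^sub>2 usplus_scale c v = usplus2_scale c (u \<otimes>\<^sub>2 v)"
  by (transfer, simp only: ten2_ideal_def pm_scale_single diff_diff_add[symmetric] mult_1_right,
      rule pm.span_base, rule tensor2_relations.intros)+

lemma tensor3_trilinear:
  "tensor3 (u + u') v w = tensor3 u v w + tensor3 u' v w"
  "tensor3 u (v + v') w = tensor3 u v w + tensor3 u v' w"
  "tensor3 u v (w + w') = tensor3 u v w + tensor3 u v w'"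
  "tensor3 (usplus_scale c u) v w = usplus3_scale c (tensor3 u v w)"
  "tensor3 u (usplus_scale c v) w = usplus3_scale c (tensor3 u v w)"
  "tensor3 u v (usplus_scale c w) = usplus3_scale c (tensor3 u v w)"
  by (transfer, simp only: ten3_ideal_def pm_scale_single diff_diff_add[symmetric] mult_1_right,
      rule pm.span_base, rule tensor3_relations.intros)+

lemma tensor2_mult: "(u \<otimes>\<^sub>2 v) * (u' \<otimes>\<^sub>2 v') = (u * u') \<otimes>\<^sub>2 (v * v')"
  by transfer (simp add: mult_single pm.subspace_0[OF ideal_sub[OF ten2_ideal]])

lemma tensor3_mult: "tensor3 u v w * tensor3 u' v' w' = tensor3 (u * u') (v * v') (w * w')"
  by transfer (simp add: mult_single pm.subspace_0[OF ideal_sub[OF ten3_ideal]])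

lemma tensor2_1: "1 \<otimes>\<^sub>2 1 = 1"
  by transfer (simp add: pm.subspace_0[OF ideal_sub[OF ten2_ideal]] flip: zero_pure2_def)

lemma tensor3_1: "tensor3 1 1 1 = 1"
  by transfer (simp add: pm.subspace_0[OF ideal_sub[OF ten3_ideal]] flip: zero_pure3_def)


section \<open>The bialgebra structure\<close>

text \<open>
  The coproduct is the algebra homomorphism with \<open>x \<mapsto> x \<otimes> 1 + 1 \<otimes> x\<close> on the Lie algebra, the
  counit \<open>usplus_counit\<close> the one with \<open>x \<mapsto> 0\<close>.
\<close>

unbundle usplus.lifting
lifting_forget usplus2.lifting

definition comult_word :: "('n::finite, 'a::field) splus word \<Rightarrow> ('n, 'a) usplus2" where
  "comult_word w = prod_list (map (\<lambda>x. incl x \<otimes>\<^sub>2 1 + 1 \<otimes>\<^sub>2 incl x) (letters w))"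

lemma comult_env_ideal:
  assumes "p \<in> (env_ideal :: (('n::finite, 'a::field) splus word \<Rightarrow>\<^sub>0 'a) set)"
  shows "lin_ext usplus2_scale comult_word p = 0"
proof (rule lin_ext_ideal_gen_eq_0[OF usplus2_vector_space _ _ _ _ assms[unfolded env_ideal_def]])
  fix r :: "('n, 'a) splus word \<Rightarrow>\<^sub>0 'a"
  assume r: "r \<in> env_relations splus_scale splus_bracket"
  have 1: "lin_ext usplus2_scale comult_word (letter x) = incl x \<otimes>\<^sub>2 1 + 1 \<otimes>\<^sub>2 incl x"
    for x :: "('n, 'a) splus"
    by (simp add: letter_def comult_word_def)
  have 2: "lin_ext usplus2_scale comult_word (letter x * letter y)
      = (incl x * incl y) \<otimes>\<^sub>2 1 + incl x \<otimes>\<^sub>2 incl y + incl y \<otimes>\<^sub>2 incl x + 1 \<otimes>\<^sub>2 (incl x * incl y)"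
    for x y :: "('n, 'a) splus"
    by (simp add: letter_def comult_word_def mult_single plus_word_def tensor2_mult algebra_simps)
  have 3: "incl (splus_bracket x y) \<otimes>\<^sub>2 v = (incl x * incl y) \<otimes>\<^sub>2 v - (incl y * incl x) \<otimes>\<^sub>2 v"
    "v \<otimes>\<^sub>2 incl (splus_bracket x y) = v \<otimes>\<^sub>2 (incl x * incl y) - v \<otimes>\<^sub>2 (incl y * incl x)"
    for x y :: "('n, 'a) splus" and v
    using tensor2_bilinear(1)[of "incl (splus_bracket x y)" "incl y * incl x" v]
      tensor2_bilinear(2)[of v "incl (splus_bracket x y)" "incl y * incl x"]
    by (simp_all add: incl_bracket)
  from r show "lin_ext usplus2_scale comult_word r = 0"
    by cases
       (simp_all add: usp2.lin_ext_minus usp2.lin_ext_scale 1 2 3 incl_add incl_scale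
          tensor2_bilinear usp2.scale_right_distrib)
qed (simp_all add: usplus2_scale_mult_left usplus2_scale_mult_right comult_word_def plus_word_def)

lift_definition usplus_comult :: "('n::finite, 'a::field) usplus \<Rightarrow> ('n, 'a) usplus2" is
  "lin_ext usplus2_scale comult_word"
  using comult_env_ideal usp2.lin_ext_minus by (metis eq_iff_diff_eq_0)

lemma usplus_comult_add: "usplus_comult (u + v) = usplus_comult u + usplus_comult v"
  by (induct u rule: usplus.abs_induct, induct v rule: usplus.abs_induct)
     (simp add: usplus_comult.abs_eq plus_usplus.abs_eq usp2.lin_ext_add)

lemma usplus_comult_scale: "usplus_comult (usplus_scale c u) = usplus2_scale c (usplus_comult u)"
  by (induct u rule: usplus.abs_induct)
     (simp add: usplus_comult.abs_eq usplus_scale.abs_eq usp2.lin_ext_scale)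

lemma usplus_comult_incl: "usplus_comult (incl x) = incl x \<otimes>\<^sub>2 1 + 1 \<otimes>\<^sub>2 incl x"
  by (simp add: usplus_comult.abs_eq incl.abs_eq letter_def comult_word_def)

lemma usplus_comult_1: "usplus_comult 1 = 1"
  by (simp add: usplus_comult.abs_eq one_usplus.abs_eq usp2.lin_ext_single[of _ 0 1, simplified]
      comult_word_def zero_word_def)

lemma usplus_comult_mult: "usplus_comult (u * v) = usplus_comult u * usplus_comult v"
proof -
  have "lin_ext usplus2_scale comult_word (p * q)
      = lin_ext usplus2_scale comult_word p * lin_ext usplus2_scale comult_word q"
    for p q :: "('a, 'b) splus word \<Rightarrow>\<^sub>0 'b"
    by (rule lin_ext_mult[OF usplus2_vector_space])
       (simp_all add: usplus2_scale_mult_left usplus2_scale_mult_right comult_word_def plus_word_def)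
  then show ?thesis
    by (induct u rule: usplus.abs_induct, induct v rule: usplus.abs_induct)
       (simp add: usplus_comult.abs_eq times_usplus.abs_eq)
qed

lemma usplus_counit_incl: "usplus_counit (incl x) = 0"
  by (simp add: usplus_counit.abs_eq incl.abs_eq letter_def counit_word_def)

text \<open>The canonical maps \<open>(u \<otimes> v) \<otimes> w \<mapsto> u \<otimes> v \<otimes> w\<close> and \<open>u \<otimes> (v \<otimes> w) \<mapsto> u \<otimes> v \<otimes> w\<close>.\<close>

lifting_forget usplus.lifting
lifting_forget usplus3.lifting
unbundle usplus2.lifting

lift_definition tensor_left :: "('n::finite, 'a::field) usplus2 \<Rightarrow> ('n, 'a) usplus \<Rightarrow> ('n, 'a) usplus3" is
  "\<lambda>p w. lin_ext usplus3_scale (case_pure2 (\<lambda>u v. tensor3 u v w)) p"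
  unfolding ten2_ideal_def by (rule ext, rule usp3.lin_ext_tensor2[where sc = usplus_scale]) (simp_all add: tensor3_trilinear)

lift_definition tensor_right :: "('n::finite, 'a::field) usplus \<Rightarrow> ('n, 'a) usplus2 \<Rightarrow> ('n, 'a) usplus3" is
  "\<lambda>u. lin_ext usplus3_scale (case_pure2 (\<lambda>v w. tensor3 u v w))"
  unfolding ten2_ideal_def by (rule usp3.lin_ext_tensor2[where sc = usplus_scale]) (simp_all add: tensor3_trilinear)


lemma tensor_left_pure: "tensor_left (u \<otimes>\<^sub>2 v) w = tensor3 u v w"
  by (simp add: tensor2_def tensor_left.abs_eq)

lemma tensor_right_pure: "tensor_right u (v \<otimes>\<^sub>2 w) = tensor3 u v w"
  by (simp add: tensor2_def tensor_right.abs_eq)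

lemma tensor_left_bilinear:
  "tensor_left (p + q) w = tensor_left p w + tensor_left q w"
  "tensor_left p (w + w') = tensor_left p w + tensor_left p w'"
  "tensor_left (usplus2_scale c p) w = usplus3_scale c (tensor_left p w)"
  "tensor_left p (usplus_scale c w) = usplus3_scale c (tensor_left p w)"
proof -
  show "tensor_left (p + q) w = tensor_left p w + tensor_left q w"
    by (induct p rule: usplus2.abs_induct, induct q rule: usplus2.abs_induct)
       (simp add: tensor_left.abs_eq tensor_right.abs_eq plus_usplus2.abs_eq usp3.lin_ext_add)
  show "tensor_left (usplus2_scale c p) w = usplus3_scale c (tensor_left p w)"
    by (induct p rule: usplus2.abs_induct)
       (simp add: tensor_left.abs_eq tensor_right.abs_eq usplus2_scale.abs_eq usp3.lin_ext_scale)
  have "case_pure2 (\<lambda>u v. tensor3 u v (w + w'))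
      = (\<lambda>k. case_pure2 (\<lambda>u v. tensor3 u v w) k + case_pure2 (\<lambda>u v. tensor3 u v w') k)"
    by (auto simp: fun_eq_iff tensor3_trilinear split: pure2.split)
  then show "tensor_left p (w + w') = tensor_left p w + tensor_left p w'"
    by (induct p rule: usplus2.abs_induct)
       (simp only: tensor_left.abs_eq tensor_right.abs_eq usp3.lin_ext_fun_add)
  have "case_pure2 (\<lambda>u v. tensor3 u v (usplus_scale c w))
      = (\<lambda>k. usplus3_scale c (case_pure2 (\<lambda>u v. tensor3 u v w) k))"
    by (auto simp: fun_eq_iff tensor3_trilinear split: pure2.split)
  then show "tensor_left p (usplus_scale c w) = usplus3_scale c (tensor_left p w)"
    by (induct p rule: usplus2.abs_induct)
       (simp only: tensor_left.abs_eq tensor_right.abs_eq usp3.lin_ext_fun_scale)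
qed

lemma tensor_right_bilinear:
  "tensor_right u (p + q) = tensor_right u p + tensor_right u q"
  "tensor_right (u + u') p = tensor_right u p + tensor_right u' p"
  "tensor_right u (usplus2_scale c p) = usplus3_scale c (tensor_right u p)"
  "tensor_right (usplus_scale c u) p = usplus3_scale c (tensor_right u p)"
proof -
  show "tensor_right u (p + q) = tensor_right u p + tensor_right u q"
    by (induct p rule: usplus2.abs_induct, induct q rule: usplus2.abs_induct)
       (simp add: tensor_left.abs_eq tensor_right.abs_eq plus_usplus2.abs_eq usp3.lin_ext_add)
  show "tensor_right u (usplus2_scale c p) = usplus3_scale c (tensor_right u p)"
    by (induct p rule: usplus2.abs_induct)
       (simp add: tensor_left.abs_eq tensor_right.abs_eq usplus2_scale.abs_eq usp3.lin_ext_scale)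
  have "case_pure2 (\<lambda>v w. tensor3 (u + u') v w)
      = (\<lambda>k. case_pure2 (\<lambda>v w. tensor3 u v w) k + case_pure2 (\<lambda>v w. tensor3 u' v w) k)"
    by (auto simp: fun_eq_iff tensor3_trilinear split: pure2.split)
  then show "tensor_right (u + u') p = tensor_right u p + tensor_right u' p"
    by (induct p rule: usplus2.abs_induct)
       (simp only: tensor_left.abs_eq tensor_right.abs_eq usp3.lin_ext_fun_add)
  have "case_pure2 (\<lambda>v w. tensor3 (usplus_scale c u) v w)
      = (\<lambda>k. usplus3_scale c (case_pure2 (\<lambda>v w. tensor3 u v w) k))"
    by (auto simp: fun_eq_iff tensor3_trilinear split: pure2.split)
  then show "tensor_right (usplus_scale c u) p = usplus3_scale c (tensor_right u p)"
    by (induct p rule: usplus2.abs_induct)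
       (simp only: tensor_left.abs_eq tensor_right.abs_eq usp3.lin_ext_fun_scale)
qed

lift_definition comult_id :: "('n::finite, 'a::field) usplus2 \<Rightarrow> ('n, 'a) usplus3" is
  "lin_ext usplus3_scale (case_pure2 (\<lambda>u v. tensor_left (usplus_comult u) v))"
  unfolding ten2_ideal_def
  by (rule usp3.lin_ext_tensor2[where sc = usplus_scale])
     (simp_all add: tensor_left_bilinear usplus_comult_add usplus_comult_scale)

lift_definition id_comult :: "('n::finite, 'a::field) usplus2 \<Rightarrow> ('n, 'a) usplus3" is
  "lin_ext usplus3_scale (case_pure2 (\<lambda>u v. tensor_right u (usplus_comult v)))"
  unfolding ten2_ideal_def
  by (rule usp3.lin_ext_tensor2[where sc = usplus_scale])
     (simp_all add: tensor_right_bilinear usplus_comult_add usplus_comult_scale)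

text \<open>\<open>\<epsilon> \<otimes> Id\<close> and \<open>Id \<otimes> \<epsilon>\<close>, with values in the algebra itself (as the base field tensored with it).\<close>

lift_definition counit_id :: "('n::finite, 'a::field) usplus2 \<Rightarrow> ('n, 'a) usplus" is
  "lin_ext usplus_scale (case_pure2 (\<lambda>u v. usplus_scale (usplus_counit u) v))"
  unfolding ten2_ideal_def
  by (rule usp.lin_ext_tensor2[where sc = usplus_scale])
     (simp_all add: usplus_counit_add usplus_counit_scale usp.scale_left_distrib
        usp.scale_right_distrib mult.commute)

lift_definition id_counit :: "('n::finite, 'a::field) usplus2 \<Rightarrow> ('n, 'a) usplus" is
  "lin_ext usplus_scale (case_pure2 (\<lambda>u v. usplus_scale (usplus_counit v) u))"
  unfolding ten2_ideal_def
  by (rule usp.lin_ext_tensor2[where sc = usplus_scale])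
     (simp_all add: usplus_counit_add usplus_counit_scale usp.scale_left_distrib
        usp.scale_right_distrib mult.commute)

lemma comult_id_pure: "comult_id (u \<otimes>\<^sub>2 v) = tensor_left (usplus_comult u) v"
  by (simp add: tensor2_def comult_id.abs_eq)

lemma id_comult_pure: "id_comult (u \<otimes>\<^sub>2 v) = tensor_right u (usplus_comult v)"
  by (simp add: tensor2_def id_comult.abs_eq)

lemma counit_id_pure: "counit_id (u \<otimes>\<^sub>2 v) = usplus_scale (usplus_counit u) v"
  by (simp add: tensor2_def counit_id.abs_eq)

lemma id_counit_pure: "id_counit (u \<otimes>\<^sub>2 v) = usplus_scale (usplus_counit v) u"
  by (simp add: tensor2_def id_counit.abs_eq)

lemma comult_id_linear:
  "comult_id (p + q) = comult_id p + comult_id q"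
  "comult_id (usplus2_scale c p) = usplus3_scale c (comult_id p)"
  by (induct p rule: usplus2.abs_induct, (induct q rule: usplus2.abs_induct)?,
      simp add: comult_id.abs_eq plus_usplus2.abs_eq usplus2_scale.abs_eq usp3.lin_ext_add usp3.lin_ext_scale
        usp.lin_ext_add usp.lin_ext_scale)+

lemma id_comult_linear:
  "id_comult (p + q) = id_comult p + id_comult q"
  "id_comult (usplus2_scale c p) = usplus3_scale c (id_comult p)"
  by (induct p rule: usplus2.abs_induct, (induct q rule: usplus2.abs_induct)?,
      simp add: id_comult.abs_eq plus_usplus2.abs_eq usplus2_scale.abs_eq usp3.lin_ext_add usp3.lin_ext_scale
        usp.lin_ext_add usp.lin_ext_scale)+

lemma counit_id_linear:
  "counit_id (p + q) = counit_id p + counit_id q"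
  "counit_id (usplus2_scale c p) = usplus_scale c (counit_id p)"
  by (induct p rule: usplus2.abs_induct, (induct q rule: usplus2.abs_induct)?,
      simp add: counit_id.abs_eq plus_usplus2.abs_eq usplus2_scale.abs_eq usp3.lin_ext_add usp3.lin_ext_scale
        usp.lin_ext_add usp.lin_ext_scale)+

lemma id_counit_linear:
  "id_counit (p + q) = id_counit p + id_counit q"
  "id_counit (usplus2_scale c p) = usplus_scale c (id_counit p)"
  by (induct p rule: usplus2.abs_induct, (induct q rule: usplus2.abs_induct)?,
      simp add: id_counit.abs_eq plus_usplus2.abs_eq usplus2_scale.abs_eq usp3.lin_ext_add usp3.lin_ext_scale
        usp.lin_ext_add usp.lin_ext_scale)+


section \<open>Drinfel'd twists\<close>

text \<open>
  The \<open>t\<close>-adically completed tensor powers of \<open>U[[t]]\<close> over the power series ring are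
  \<open>(U \<otimes> U)[[t]]\<close> and \<open>(U \<otimes> U \<otimes> U)[[t]]\<close>, and the structure maps are extended to power series in \<open>t\<close>
  coefficientwise.
\<close>

definition fps_map :: "('b \<Rightarrow> 'c) \<Rightarrow> 'b fps \<Rightarrow> 'c fps" where
  "fps_map f F = Abs_fps (\<lambda>r. f (fps_nth F r))"

definition drinfeld_twist :: "('n::finite, 'a::field) usplus2 fps \<Rightarrow> bool" where
  "drinfeld_twist F \<longleftrightarrow>
     (\<exists>G. F * G = 1 \<and> G * F = 1) \<and>
     fps_map (\<lambda>p. tensor_left p 1) F * fps_map comult_id F
       = fps_map (tensor_right 1) F * fps_map id_comult F \<and>
     fps_map counit_id F = 1 \<and> fps_map id_counit F = 1"

text \<open>The factorial power \<open>x(x-1)\<dots>(x-r+1)\<close>.\<close>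

definition falling :: "'r::ring_1 \<Rightarrow> nat \<Rightarrow> 'r" where
  "falling x r = prod_list (map (\<lambda>k. x - of_nat k) [0..<r])"

definition basic_twist :: "'n::finite \<Rightarrow> 'n \<Rightarrow> ('n, 'a::field_char_0) usplus2 fps" where
  "basic_twist i j = Abs_fps (\<lambda>r.
     usplus2_scale ((-1) ^ r / fact r) (falling (incl (h_elt i j)) r \<otimes>\<^sub>2 incl (e_elt i j) ^ r))"

end

theory Submission
  imports Defs
begin

text \<open>
  A product of two twists is again a twist as soon as the \<open>F \<otimes> 1\<close> of the second commutes with
  \<open>(\<Delta> \<otimes> Id)(F)\<close> of the first, and likewise on the other side. For basic twists this can be read off
  the generators: the coefficient of \<open>t\<^sup>2\<close> in \<open>[F(i,j), F(k,m)] = 0\<close> is \<open>h h' \<otimes> [e, e'] = 0\<close>.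
  Letting the enveloping algebra act on polynomials, where \<open>h h'\<close> does not annihilate a monomial
  with pairwise different exponents, gives \<open>[e, e'] = 0\<close>. This forces \<open>i \<noteq> k\<close>, \<open>j \<noteq> k\<close> and \<open>i \<noteq> m\<close>,
  so that \<open>h, e\<close> commute with \<open>h', e'\<close>. That a single basic twist is a twist
  follows by comparing coefficients. With \<open>h e = e (h + 1)\<close> and Vandermonde's identity, both sides of
  the cocycle equation become the same sum over \<open>a + p + c + l = N\<close>.
\<close>

section \<open>Falling factorials in noncommutative rings\<close>

lemma falling_0 [simp]: "falling x 0 = 1"
  by (simp add: falling_def)

lemma falling_Suc: "falling x (Suc r) = falling x r * (x - of_nat r)"
  by (simp add: falling_def)

lemma falling_1: "falling x (Suc 0) = x"
  by (simp add: falling_Suc)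

lemma commute_diff_of_nat:
  fixes x y :: "'r::ring_1"
  shows "x * y = y * x \<Longrightarrow> (x - of_nat k) * y = y * (x - of_nat k)"
  by (simp add: algebra_simps mult_of_nat_commute)

lemma commute_power:
  fixes x y :: "'r::monoid_mult"
  shows "x * y = y * x \<Longrightarrow> x ^ r * y = y * x ^ r"
  by (metis power_commuting_commutes)

lemma commute_falling:
  assumes "x * y = y * x"
  shows "falling x r * y = y * falling x r"
proof (induction r)
  case (Suc r)
  then show ?case
    by (simp only: falling_Suc mult.assoc commute_diff_of_nat[OF assms])
       (simp add: Suc flip: mult.assoc)
qed simp

lemma falling_left_factor: "r > 0 \<Longrightarrow> \<exists>y. falling x r = x * y"
proof (induction r)
  case (Suc r)
  then show ?case
    by (cases "r = 0") (auto simp: falling_Suc mult.assoc intro: exI[of _ 1])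
qed simp

text \<open>Cuts the product x(x-1)...(x-a-c+1) after its first \<open>a\<close> factors.\<close>

lemma falling_add_shift: "falling x a * falling (x - of_nat a) c = falling x (a + c)"
proof (induction c)
  case (Suc c)
  have "x - of_nat a - of_nat c = x - of_nat (a + c)" by simp
  with Suc show ?case by (simp only: falling_Suc add_Suc_right mult.assoc[symmetric])
qed simp

lemma falling_of_nat: "falling (of_nat b) p = of_nat (fact p * (b choose p))"
proof (induction p)
  case (Suc p)
  have "falling (of_nat b :: 'a) (Suc p) = of_nat (fact p) * (of_nat (b choose p) * (of_nat b - of_nat p))"
    by (simp add: falling_Suc Suc mult.assoc)
  \<comment> \<open>The subtraction \<open>b - p\<close> is truncated, which is harmless: for p > b
    the binomial coefficient vanishes.\<close>
  also have "of_nat (b choose p) * (of_nat b - of_nat p) = (of_nat ((b - p) * (b choose p)) :: 'a)"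
  proof (cases "p \<le> b")
    case True
    then show ?thesis by (simp only: of_nat_diff[symmetric] of_nat_mult[symmetric] mult.commute)
  qed (simp add: binomial_eq_0)
  also have "(b - p) * (b choose p) = Suc p * (b choose Suc p)"
    by (metis binomial_absorb_comp binomial_absorption)
  also have "of_nat (fact p) * of_nat (Suc p * (b choose Suc p))
      = (of_nat (fact p * (Suc p * (b choose Suc p))) :: 'a)"
    by (rule of_nat_mult[symmetric])
  also have "fact p * (Suc p * (b choose Suc p)) = fact (Suc p) * (b choose Suc p)"
    by (simp only: fact_Suc of_nat_id ac_simps)
  finally show ?case .
qed simp

lemma mult_of_nat_left_commute:
  fixes x y :: "'r::semiring_1"
  shows "x * (of_nat c * y) = of_nat c * (x * y)"
  by (metis mult.assoc mult_of_nat_commute)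

text \<open>Pascal's rule in summed form. It is the induction step shared by Vandermonde's identity
  and the binomial theorem, where one more factor turns \<open>T k l\<close> into
  \<open>T (Suc k) l + T k (Suc l)\<close>.\<close>

lemma binomial_sum_Suc:
  fixes T :: "nat \<Rightarrow> nat \<Rightarrow> 'r::ring_1"
  shows "(\<Sum>k\<le>n. of_nat (n choose k) * (T (Suc k) (n - k) + T k (Suc (n - k))))
    = (\<Sum>k\<le>Suc n. of_nat (Suc n choose k) * T k (Suc n - k))"
proof -
  have "(\<Sum>k\<le>Suc n. of_nat (Suc n choose k) * T k (Suc n - k))
      = T 0 (Suc n) + (\<Sum>k\<le>n. of_nat (Suc n choose Suc k) * T (Suc k) (n - k))"
    by (subst sum.atMost_Suc_shift) simp
  also have "\<dots> = (\<Sum>k\<le>n. of_nat (n choose k) * T (Suc k) (n - k))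
      + (T 0 (Suc n) + (\<Sum>k\<le>n. of_nat (n choose Suc k) * T (Suc k) (n - k)))"
    by (simp add: distrib_right sum.distrib)
  also have "T 0 (Suc n) + (\<Sum>k\<le>n. of_nat (n choose Suc k) * T (Suc k) (n - k))
      = (\<Sum>k\<le>Suc n. of_nat (n choose k) * T k (Suc n - k))"
    by (subst sum.atMost_Suc_shift) simp
  also have "\<dots> = (\<Sum>k\<le>n. of_nat (n choose k) * T k (Suc (n - k)))"
    by (simp add: Suc_diff_le binomial_eq_0)
  finally show ?thesis by (simp add: distrib_left sum.distrib)
qed

text \<open>Vandermonde's identity for commuting elements. In the induction step the new factor x +
  y - n splits as (x - k) + (y - (n - k)), and each summand lengthens one of the two falling
  factorials by its next factor.\<close>

lemma falling_add:
  fixes x y :: "'r::ring_1"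
  assumes "x * y = y * x"
  shows "falling (x + y) n = (\<Sum>k\<le>n. of_nat (n choose k) * (falling x k * falling y (n - k)))"
proof (induction n)
  case (Suc n)
  have "falling x k * falling y (n - k) * (x + y - of_nat n)
      = falling x (Suc k) * falling y (n - k) + falling x k * falling y (Suc (n - k))"
    if "k \<le> n" for k
  proof -
    have *: "x + y - of_nat n = (x - of_nat k) + (y - of_nat (n - k))"
      using that by (simp add: of_nat_diff)
    have "falling y (n - k) * (x - of_nat k) = (x - of_nat k) * falling y (n - k)"
      by (rule commute_falling, rule commute_diff_of_nat[symmetric], rule assms)
    then show ?thesis
      unfolding * by (simp only: distrib_left falling_Suc mult.assoc)
  qed
  then have "falling (x + y) (Suc n) = (\<Sum>k\<le>n. of_nat (n choose k) *
      (falling x (Suc k) * falling y (n - k) + falling x k * falling y (Suc (n - k))))"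
    by (simp add: falling_Suc[of "x + y"] Suc sum_distrib_right mult.assoc)
  then show ?case
    by (simp only: binomial_sum_Suc[of n "\<lambda>k l. falling x k * falling y l"])
qed simp

lemma power_add_commute:
  fixes x y :: "'r::ring_1"
  assumes "x * y = y * x"
  shows "(x + y) ^ n = (\<Sum>k\<le>n. of_nat (n choose k) * (x ^ k * y ^ (n - k)))"
proof (induction n)
  case (Suc n)
  have "x ^ k * y ^ (n - k) * (x + y) = x ^ Suc k * y ^ (n - k) + x ^ k * y ^ Suc (n - k)" for k
    using commute_power[of y x "n - k"] assms
    by (simp only: distrib_left power_Suc2 mult.assoc)
  then have "(x + y) ^ Suc n = (\<Sum>k\<le>n. of_nat (n choose k) *
      (x ^ Suc k * y ^ (n - k) + x ^ k * y ^ Suc (n - k)))"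
    by (simp only: power_Suc2[of "x + y"] Suc sum_distrib_right mult.assoc)
  then show ?case
    by (simp only: binomial_sum_Suc[of n "\<lambda>k l. x ^ k * y ^ l"])
qed simp

text \<open>Vandermonde applied to h = a + (h - a): the part at the integer \<open>a\<close> becomes
  the coefficient p! (a choose p), and the part at h - a continues \<open>falling h a\<close>
  without a gap.\<close>

lemma falling_mult_falling:
  fixes h :: "'r::ring_1"
  shows "falling h a * falling h k
    = (\<Sum>p\<le>k. of_nat ((k choose p) * (fact p * (a choose p))) * falling h (a + (k - p)))"
proof -
  have "of_nat a * (h - of_nat a) = (h - of_nat a) * of_nat a"
    by (rule mult_of_nat_commute)
  note falling_add[OF this, of k]
  then have "falling h k = (\<Sum>p\<le>k. of_nat ((k choose p) * (fact p * (a choose p))) * falling (h - of_nat a) (k - p))"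
    by (simp only: of_nat_mult mult.assoc falling_of_nat add_diff_eq add_diff_cancel_left')
  then show ?thesis
    by (simp only: sum_distrib_left falling_add_shift[symmetric] mult_of_nat_left_commute)
qed

text \<open>Moving h past e^b shifts it to h + b, so Vandermonde with the integer b applies. The
  coefficients have the same form as in \<open>falling_mult_falling\<close>, which is what makes the
  two sides of the cocycle equation match.\<close>

lemma falling_mult_power:
  fixes h e :: "'r::ring_1"
  assumes "h * e = e * (h + 1)"
  shows "falling h l * e ^ b
    = (\<Sum>p\<le>l. of_nat ((l choose p) * (fact p * (b choose p))) * (e ^ b * falling h (l - p)))"
proof -
  have 1: "h * e ^ b = e ^ b * (h + of_nat b)"
  proof (induction b)
    case (Suc b)
    have "h * e ^ Suc b = e ^ b * (h * e + of_nat b * e)"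
      using Suc by (simp only: power_Suc2 mult.assoc[symmetric]) (simp add: algebra_simps)
    also have "h * e + of_nat b * e = e * (h + of_nat (Suc b))"
      by (simp add: assms algebra_simps mult_of_nat_commute)
    finally show ?case by (simp only: power_Suc2 mult.assoc)
  qed simp
  have 2: "(h - of_nat k) * e ^ b = e ^ b * (h + of_nat b - of_nat k)" for k
    by (simp add: 1 left_diff_distrib right_diff_distrib mult_of_nat_commute)
  have "falling h l * e ^ b = e ^ b * falling (h + of_nat b) l"
  proof (induction l)
    case (Suc l)
    then show ?case
      by (simp only: falling_Suc mult.assoc 2) (simp only: mult.assoc[symmetric])
  qed simp
  also have "falling (h + of_nat b) l
      = (\<Sum>p\<le>l. of_nat ((l choose p) * (fact p * (b choose p))) * falling h (l - p))"
    using falling_add[OF mult_of_nat_commute, of b h l]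
    by (simp only: of_nat_mult mult.assoc falling_of_nat add.commute[of h])
  also have "e ^ b * \<dots> = (\<Sum>p\<le>l. of_nat ((l choose p) * (fact p * (b choose p))) * (e ^ b * falling h (l - p)))"
    by (simp only: sum_distrib_left mult_of_nat_left_commute)
  finally show ?thesis .
qed

section \<open>Structure maps as ring homomorphisms\<close>

definition unital_ring_hom :: "('r::ring_1 \<Rightarrow> 's::ring_1) \<Rightarrow> bool" where
  "unital_ring_hom f \<longleftrightarrow> f 1 = 1 \<and> (\<forall>x y. f (x + y) = f x + f y) \<and> (\<forall>x y. f (x * y) = f x * f y)"

context
  fixes f :: "'r::ring_1 \<Rightarrow> 's::ring_1"
  assumes f: "unital_ring_hom f"
begin

lemma hom_1: "f 1 = 1" and hom_add: "f (x + y) = f x + f y" and hom_mult: "f (x * y) = f x * f y"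
  using f by (simp_all add: unital_ring_hom_def)

lemma hom_0: "f 0 = 0"
  using hom_add[of 0 0] by simp

lemma hom_diff: "f (x - y) = f x - f y"
  using hom_add[of "x - y" y] by simp

lemma hom_sum: "f (\<Sum>x\<in>A. g x) = (\<Sum>x\<in>A. f (g x))"
  by (induction A rule: infinite_finite_induct) (simp_all add: hom_0 hom_add)

lemma hom_of_nat: "f (of_nat n) = of_nat n"
  by (induction n) (simp_all add: hom_0 hom_1 hom_add)

lemma hom_power: "f (x ^ n) = f x ^ n"
  by (induction n) (simp_all add: hom_1 hom_mult)

lemma hom_falling: "f (falling x n) = falling (f x) n"
  by (induction n) (simp_all add: hom_1 falling_Suc hom_mult hom_diff hom_of_nat)

text \<open>Each coefficient of a Cauchy product is a finite sum of products, which \<open>f\<close>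
  respects.\<close>

lemma unital_ring_hom_fps_map: "unital_ring_hom (fps_map f)"
  unfolding unital_ring_hom_def fps_map_def
  by (auto intro!: fps_ext simp: hom_0 hom_1 hom_add hom_mult fps_mult_nth hom_sum fps_one_nth)

end

lemma hom_prod_list: "unital_ring_hom f \<Longrightarrow> f (prod_list xs) = prod_list (map f xs)"
  by (induction xs) (simp_all add: hom_1 hom_mult)

section \<open>Reduction to pure tensors and multiplicativity of the structure maps\<close>

lemma usplus2_induct [case_names pure add]:
  fixes P :: "('n::finite, 'a::field) usplus2 \<Rightarrow> bool"
  assumes pure: "\<And>u v. P (u \<otimes>\<^sub>2 v)" and add: "\<And>p q. P p \<Longrightarrow> P q \<Longrightarrow> P (p + q)"
  shows "P p"
proof (induct p rule: usplus2.abs_induct)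
  fix y :: "('n, 'a) usplus pure2 \<Rightarrow>\<^sub>0 'a"
  show "P (abs_usplus2 y)"
  proof (induction y rule: pm_induct)
    case zero
    have "abs_usplus2 0 = usplus2_scale 0 (1 \<otimes>\<^sub>2 (1 :: ('n, 'a) usplus))"
      by (simp add: zero_usplus2.abs_eq)
    then show ?case using pure by (simp flip: tensor2_bilinear)
  next
    case (single k c)
    obtain u v where k: "k = Pure2 u v" by (cases k)
    have "abs_usplus2 (single k c) = usplus2_scale c (u \<otimes>\<^sub>2 v)"
      by (simp add: k tensor2_def usplus2_scale.abs_eq)
    then show ?case using pure by (simp flip: tensor2_bilinear)
  next
    case (add p q)
    then show ?case using assms(2) by (simp add: plus_usplus2.abs_eq[symmetric])
  qed
qed

text \<open>Scalars can be absorbed into a tensor factor, so pure tensors generate additively;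
  distributivity then extends multiplicativity first to the right argument, then to the left
  one.\<close>

lemma unital_ring_hom_usplus2I:
  fixes f :: "('n::finite, 'a::field) usplus2 \<Rightarrow> 's::ring_1"
  assumes one: "f (1 \<otimes>\<^sub>2 1) = 1" and add: "\<And>p q. f (p + q) = f p + f q"
    and pure: "\<And>u v u' v'. f ((u \<otimes>\<^sub>2 v) * (u' \<otimes>\<^sub>2 v')) = f (u \<otimes>\<^sub>2 v) * f (u' \<otimes>\<^sub>2 v')"
  shows "unital_ring_hom f"
proof -
  have 1: "f ((u \<otimes>\<^sub>2 v) * q) = f (u \<otimes>\<^sub>2 v) * f q" for u v q
    by (induction q rule: usplus2_induct) (simp_all add: pure add distrib_left)
  have "f (p * q) = f p * f q" for p q
    by (induction p rule: usplus2_induct) (simp_all add: 1 add distrib_right)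
  then show ?thesis using one by (simp add: unital_ring_hom_def add tensor2_1)
qed

lemma hom_usplus_comult: "unital_ring_hom (usplus_comult :: ('n::finite, 'a::field) usplus \<Rightarrow> _)"
  by (simp add: unital_ring_hom_def usplus_comult_1 usplus_comult_add usplus_comult_mult)

lemma usplus_counit_mult: "usplus_counit (u * v) = usplus_counit u * usplus_counit v"
proof -
  have "lin_ext (*) counit_word (p * q) = lin_ext (*) counit_word p * lin_ext (*) counit_word q"
    for p q :: "('b, 'a) splus word \<Rightarrow>\<^sub>0 'a"
    by (rule lin_ext_mult[OF field_vector_space]) (simp_all add: counit_word_def plus_word_def)
  then show ?thesis
    by (induct u rule: usplus.abs_induct, induct v rule: usplus.abs_induct)
       (simp add: usplus_counit.abs_eq times_usplus.abs_eq)
qed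

lemma hom_usplus_counit: "unital_ring_hom (usplus_counit :: ('n::finite, 'a::field) usplus \<Rightarrow> _)"
  by (simp add: unital_ring_hom_def usplus_counit_add usplus_counit_mult)

lemma hom_tensor2_left: "unital_ring_hom (\<lambda>u :: ('n::finite, 'a::field) usplus. u \<otimes>\<^sub>2 1)"
  by (simp add: unital_ring_hom_def tensor2_1 tensor2_bilinear tensor2_mult)

lemma hom_tensor2_right: "unital_ring_hom (\<lambda>u :: ('n::finite, 'a::field) usplus. 1 \<otimes>\<^sub>2 u)"
  by (simp add: unital_ring_hom_def tensor2_1 tensor2_bilinear tensor2_mult)

lemma tensor_left_mult: "tensor_left p w * tensor_left q w' = tensor_left (p * q) (w * w')"
proof -
  have "tensor_left (u \<otimes>\<^sub>2 v) w * tensor_left q w' = tensor_left ((u \<otimes>\<^sub>2 v) * q) (w * w')" for u v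
    by (induction q rule: usplus2_induct)
       (simp_all add: tensor_left_pure tensor2_mult tensor3_mult tensor_left_bilinear distrib_left)
  then show ?thesis
    by (induction p rule: usplus2_induct) (simp_all add: tensor_left_bilinear distrib_right)
qed

lemma tensor_right_mult: "tensor_right w p * tensor_right w' q = tensor_right (w * w') (p * q)"
proof -
  have "tensor_right w (u \<otimes>\<^sub>2 v) * tensor_right w' q = tensor_right (w * w') ((u \<otimes>\<^sub>2 v) * q)" for u v
    by (induction q rule: usplus2_induct)
       (simp_all add: tensor_right_pure tensor2_mult tensor3_mult tensor_right_bilinear distrib_left)
  then show ?thesis
    by (induction p rule: usplus2_induct) (simp_all add: tensor_right_bilinear distrib_right)
qed

lemma hom_tensor_left: "unital_ring_hom (\<lambda>p :: ('n::finite, 'a::field) usplus2. tensor_left p 1)"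
  by (rule unital_ring_hom_usplus2I)
     (simp_all add: tensor_left_bilinear tensor_left_pure tensor2_mult tensor3_mult tensor3_1)

lemma hom_tensor_right: "unital_ring_hom (tensor_right 1 :: ('n::finite, 'a::field) usplus2 \<Rightarrow> _)"
  by (rule unital_ring_hom_usplus2I)
     (simp_all add: tensor_right_bilinear tensor_right_pure tensor2_mult tensor3_mult tensor3_1)

lemma hom_comult_id: "unital_ring_hom (comult_id :: ('n::finite, 'a::field) usplus2 \<Rightarrow> _)"
proof (rule unital_ring_hom_usplus2I)
  show "comult_id (1 \<otimes>\<^sub>2 1 :: ('n, 'a) usplus2) = 1"
    by (simp add: comult_id_pure usplus_comult_1 tensor_left_pure tensor3_1 flip: tensor2_1)
qed (simp_all add: comult_id_linear comult_id_pure tensor2_mult tensor_left_mult usplus_comult_mult)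

lemma hom_id_comult: "unital_ring_hom (id_comult :: ('n::finite, 'a::field) usplus2 \<Rightarrow> _)"
proof (rule unital_ring_hom_usplus2I)
  show "id_comult (1 \<otimes>\<^sub>2 1 :: ('n, 'a) usplus2) = 1"
    by (simp add: id_comult_pure usplus_comult_1 tensor_right_pure tensor3_1 flip: tensor2_1)
qed (simp_all add: id_comult_linear id_comult_pure tensor2_mult tensor_right_mult usplus_comult_mult)

lemma hom_counit_id: "unital_ring_hom (counit_id :: ('n::finite, 'a::field) usplus2 \<Rightarrow> _)"
  by (rule unital_ring_hom_usplus2I)
     (simp_all add: counit_id_linear counit_id_pure tensor2_mult usplus_counit_mult
        usplus_scale_mult_left usplus_scale_mult_right)

lemma hom_id_counit: "unital_ring_hom (id_counit :: ('n::finite, 'a::field) usplus2 \<Rightarrow> _)"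
  by (rule unital_ring_hom_usplus2I)
     (simp_all add: id_counit_linear id_counit_pure tensor2_mult usplus_counit_mult
        usplus_scale_mult_left usplus_scale_mult_right mult.commute)

lemmas twist_homs = hom_tensor_left hom_tensor_right hom_comult_id hom_id_comult
  hom_counit_id hom_id_counit

section \<open>Products of twists\<close>

lemma drinfeld_twist_1: "drinfeld_twist 1"
  unfolding drinfeld_twist_def
  by (auto simp: twist_homs[THEN unital_ring_hom_fps_map, THEN hom_1] intro: exI[of _ 1])

lemma drinfeld_twist_mult:
  assumes F: "drinfeld_twist F" and G: "drinfeld_twist G"
    and left: "fps_map (\<lambda>p. tensor_left p 1) G * fps_map comult_id F
      = fps_map comult_id F * fps_map (\<lambda>p. tensor_left p 1) G"
    and right: "fps_map (tensor_right 1) G * fps_map id_comult F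
      = fps_map id_comult F * fps_map (tensor_right 1) G"
  shows "drinfeld_twist (F * G)"
proof -
  obtain F' G' where "F * F' = 1" "F' * F = 1" "G * G' = 1" "G' * G = 1"
    using F G by (auto simp: drinfeld_twist_def)
  then have "(F * G) * (G' * F') = 1" "(G' * F') * (F * G) = 1"
    by (metis mult.assoc mult_1_left)+
  then have inv: "\<exists>H. (F * G) * H = 1 \<and> H * (F * G) = 1" by blast
  \<comment> \<open>Each side of the cocycle equation for \<open>F * G\<close> is a product of four
    factors. Exchanging the middle two turns it into the equation for \<open>F\<close> times the
    equation for \<open>G\<close>.\<close>
  have swap: "(a * b) * (c * d) = (a * c) * (b * d)" if "b * c = c * b"
    for a b c d :: "('a, 'b) usplus3 fps"
    using that by (metis mult.assoc)
  note hom = twist_homs[THEN unital_ring_hom_fps_map, THEN hom_mult]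
  show ?thesis
    using F G unfolding drinfeld_twist_def
    by (simp only: hom swap[OF left] swap[OF right] inv mult_1_left simp_thms)
qed

section \<open>The cocycle equation for a basic twist\<close>

unbundle fps_syntax

lemma of_nat_mult_usplus: "of_nat k * u = usplus_scale (of_nat k) (u :: ('n::finite, 'a::field) usplus)"
  by (induction k) (simp_all add: algebra_simps usp.scale_left_distrib)

lemma of_nat_mult_usplus2: "of_nat k * u = usplus2_scale (of_nat k) (u :: ('n::finite, 'a::field) usplus2)"
  by (induction k) (simp_all add: algebra_simps usp2.scale_left_distrib)

lemma usplus3_scale_mult_left: "usplus3_scale c u * v = usplus3_scale c (u * v)"
  by (induct u rule: usplus3.abs_induct, induct v rule: usplus3.abs_induct)
     (simp add: usplus3_scale.abs_eq times_usplus3.abs_eq pm_mult_scale_left)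

lemma usplus3_scale_mult_right: "u * usplus3_scale c v = usplus3_scale c (u * v)"
  by (induct u rule: usplus3.abs_induct, induct v rule: usplus3.abs_induct)
     (simp add: usplus3_scale.abs_eq times_usplus3.abs_eq pm_mult_scale_right)

lemma sum_additive:
  assumes "\<And>x y. g (x + y) = g x + g y" "g 0 = (0 :: 'v::comm_monoid_add)"
  shows "g (\<Sum>x\<in>A. f x) = (\<Sum>x\<in>A. g (f x))"
  using assms by (induction A rule: infinite_finite_induct) simp_all

lemma tensor3_0 [simp]: "tensor3 0 v w = 0" "tensor3 u 0 w = 0" "tensor3 u v 0 = 0"
  using tensor3_trilinear(4)[of 0 0 v w] tensor3_trilinear(5)[of u 0 0 w] tensor3_trilinear(6)[of u v 0 0]
  by simp_all

lemma tensor3_sum: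
  "tensor3 (\<Sum>x\<in>A. f x) v w = (\<Sum>x\<in>A. tensor3 (f x) v w)"
  "tensor3 u (\<Sum>x\<in>A. f x) w = (\<Sum>x\<in>A. tensor3 u (f x) w)"
  "tensor3 u v (\<Sum>x\<in>A. f x) = (\<Sum>x\<in>A. tensor3 u v (f x))"
proof -
  show "tensor3 (\<Sum>x\<in>A. f x) v w = (\<Sum>x\<in>A. tensor3 (f x) v w)"
    by (rule sum_additive[where g = "\<lambda>u. tensor3 u v w"]) (simp_all add: tensor3_trilinear)
  show "tensor3 u (\<Sum>x\<in>A. f x) w = (\<Sum>x\<in>A. tensor3 u (f x) w)"
    by (rule sum_additive[where g = "\<lambda>v. tensor3 u v w"]) (simp_all add: tensor3_trilinear)
  show "tensor3 u v (\<Sum>x\<in>A. f x) = (\<Sum>x\<in>A. tensor3 u v (f x))"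
    by (rule sum_additive) (simp_all add: tensor3_trilinear)
qed

lemma tensor_left_sum: "tensor_left (\<Sum>x\<in>A. f x) w = (\<Sum>x\<in>A. tensor_left (f x) w)"
proof (rule sum_additive[where g = "\<lambda>p. tensor_left p w"])
  show "tensor_left 0 w = 0"
    using tensor_left_bilinear(3)[of 0 0 w] by simp
qed (simp_all add: tensor_left_bilinear)

lemma tensor_right_sum: "tensor_right w (\<Sum>x\<in>A. f x) = (\<Sum>x\<in>A. tensor_right w (f x))"
proof (rule sum_additive)
  show "tensor_right w 0 = 0"
    using tensor_right_bilinear(3)[of w 0 0] by simp
qed (simp_all add: tensor_right_bilinear)

text \<open>Lie algebra elements are primitive, and the summands x \<otimes> 1 and 1 \<otimes> x
  commute, so Vandermonde applies to their sum.\<close>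

lemma usplus_comult_falling_incl:
  "usplus_comult (falling (incl x) r)
    = (\<Sum>k\<le>r. usplus2_scale (of_nat (r choose k)) (falling (incl x) k \<otimes>\<^sub>2 falling (incl x) (r - k)))"
proof -
  have "usplus_comult (falling (incl x) r) = falling (incl x \<otimes>\<^sub>2 1 + 1 \<otimes>\<^sub>2 incl x) r"
    by (simp add: hom_falling[OF hom_usplus_comult] usplus_comult_incl)
  also have "\<dots> = (\<Sum>k\<le>r. of_nat (r choose k) * (falling (incl x \<otimes>\<^sub>2 1) k * falling (1 \<otimes>\<^sub>2 incl x) (r - k)))"
    by (rule falling_add) (simp add: tensor2_mult)
  also have "\<dots> = (\<Sum>k\<le>r. usplus2_scale (of_nat (r choose k)) (falling (incl x) k \<otimes>\<^sub>2 falling (incl x) (r - k)))"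
    by (simp add: tensor2_mult of_nat_mult_usplus2 flip: hom_falling[OF hom_tensor2_left] hom_falling[OF hom_tensor2_right])
  finally show ?thesis .
qed

lemma usplus_comult_power_incl:
  "usplus_comult (incl x ^ r)
    = (\<Sum>k\<le>r. usplus2_scale (of_nat (r choose k)) (incl x ^ k \<otimes>\<^sub>2 incl x ^ (r - k)))"
proof -
  have "usplus_comult (incl x ^ r) = (incl x \<otimes>\<^sub>2 1 + 1 \<otimes>\<^sub>2 incl x) ^ r"
    by (simp add: hom_power[OF hom_usplus_comult] usplus_comult_incl)
  also have "\<dots> = (\<Sum>k\<le>r. of_nat (r choose k) * ((incl x \<otimes>\<^sub>2 1) ^ k * (1 \<otimes>\<^sub>2 incl x) ^ (r - k)))"
    by (rule power_add_commute) (simp add: tensor2_mult)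
  also have "\<dots> = (\<Sum>k\<le>r. usplus2_scale (of_nat (r choose k)) (incl x ^ k \<otimes>\<^sub>2 incl x ^ (r - k)))"
    by (simp add: tensor2_mult of_nat_mult_usplus2 flip: hom_power[OF hom_tensor2_left] hom_power[OF hom_tensor2_right])
  finally show ?thesis .
qed

lemma fps_map_nth [simp]: "fps_map f F $ r = f (F $ r)"
  by (simp add: fps_map_def)

section \<open>Bookkeeping of signs and factorials\<close>

lemma choose_mult_fact_div_fact:
  fixes x :: "'a::field_char_0"
  assumes "p \<le> k"
  shows "x / (y * z) / fact k * of_nat ((k choose p) * (fact p * q)) = x * of_nat q / (y * fact (k - p) * z)"
proof -
  have "of_nat ((k choose p) * (fact p * q)) = (fact p * of_nat (k choose p)) * (of_nat q :: 'a)"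
    by (simp only: of_nat_mult of_nat_fact mult_ac)
  also have "\<dots> = fact k / fact (k - p) * (of_nat q :: 'a)"
    by (simp only: fact_binomial[OF assms])
  finally show ?thesis
    by (simp only: times_divide_eq_left times_divide_eq_right divide_divide_eq_left) simp
qed

lemma power_div_mult_power_div:
  fixes x :: "'a::field"
  assumes "a \<le> N"
  shows "x ^ (N - a) / (d * d') * (x ^ a / c) = x ^ N / (c * d') / d"
proof -
  have "x ^ N = x ^ a * x ^ (N - a)"
    using assms by (metis le_add_diff_inverse power_add)
  then show ?thesis by (simp only: times_divide_times_eq divide_divide_eq_left mult_ac)
qed

text \<open>The common summand of both sides of the cocycle equation in degree a + p + c + l. On the
  left, \<open>a\<close> is the degree in F \<otimes> 1, and the coproduct puts p + c into the first
  leg and \<open>l\<close> into the second. On the right, p + l is the degree in 1 \<otimes> F, and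
  the coproduct puts \<open>a\<close> into the second leg and \<open>c\<close> into the
  third.\<close>

definition cocycle_term :: "('n::finite, 'a::field_char_0) usplus \<Rightarrow> ('n, 'a) usplus
    \<Rightarrow> nat \<Rightarrow> nat \<Rightarrow> nat \<Rightarrow> nat \<Rightarrow> ('n, 'a) usplus3" where
  "cocycle_term h e a p c l = usplus3_scale ((-1) ^ (a + p + c + l) * of_nat (a choose p) / (fact a * fact c * fact l))
     (tensor3 (falling h (a + c)) (e ^ a * falling h l) (e ^ (p + c + l)))"

context
  fixes i j :: "'n::finite" and h e :: "('n, 'a::field_char_0) usplus"
  defines "h \<equiv> incl (h_elt i j)" and "e \<equiv> incl (e_elt i j)"
begin

lemma basic_twist_nth: "basic_twist i j $ r = usplus2_scale ((-1) ^ r / fact r) (falling h r \<otimes>\<^sub>2 e ^ r)"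
  by (simp add: basic_twist_def h_def e_def)

lemma left_twist_nth: "fps_map (\<lambda>p. tensor_left p 1) (basic_twist i j) $ r
    = usplus3_scale ((-1) ^ r / fact r) (tensor3 (falling h r) (e ^ r) 1)"
  by (simp add: basic_twist_nth tensor_left_bilinear tensor_left_pure)

lemma right_twist_nth: "fps_map (tensor_right 1) (basic_twist i j) $ r
    = usplus3_scale ((-1) ^ r / fact r) (tensor3 1 (falling h r) (e ^ r))"
  by (simp add: basic_twist_nth tensor_right_bilinear tensor_right_pure)

lemma comult_id_twist_nth: "fps_map comult_id (basic_twist i j) $ r
    = (\<Sum>k\<le>r. usplus3_scale ((-1) ^ r / (fact k * fact (r - k))) (tensor3 (falling h k) (falling h (r - k)) (e ^ r)))"
  by (simp add: basic_twist_nth comult_id_linear comult_id_pure h_def usplus_comult_falling_incl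
      tensor_left_sum tensor_left_bilinear tensor_left_pure usp3.scale_sum_right binomial_fact mult.commute)

lemma id_comult_twist_nth: "fps_map id_comult (basic_twist i j) $ r
    = (\<Sum>k\<le>r. usplus3_scale ((-1) ^ r / (fact k * fact (r - k))) (tensor3 (falling h r) (e ^ k) (e ^ (r - k))))"
  by (simp add: basic_twist_nth id_comult_linear id_comult_pure e_def usplus_comult_power_incl
      tensor_right_sum tensor_right_bilinear tensor_right_pure usp3.scale_sum_right binomial_fact mult.commute)

text \<open>Every falling factorial of positive length has the factor h, which the counit kills;
  only the constant term survives.\<close>

lemma counit_id_twist: "fps_map counit_id (basic_twist i j :: ('n, 'a) usplus2 fps) = 1"
proof (rule fps_ext)
  fix r
  have "usplus_counit (falling h r) = 0" if "r > 0"
    using falling_left_factor[OF that, of h] by (auto simp: usplus_counit_mult h_def usplus_counit_incl)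
  then show "fps_map counit_id (basic_twist i j :: ('n, 'a) usplus2 fps) $ r = 1 $ r"
    by (cases "r = 0") (simp_all add: basic_twist_nth counit_id_linear counit_id_pure)
qed

lemma id_counit_twist: "fps_map id_counit (basic_twist i j :: ('n, 'a) usplus2 fps) = 1"
proof (rule fps_ext)
  fix r
  have "usplus_counit (e ^ r) = 0" if "r > 0"
    using that by (simp add: hom_power[OF hom_usplus_counit] e_def usplus_counit_incl)
  then show "fps_map id_counit (basic_twist i j :: ('n, 'a) usplus2 fps) $ r = 1 $ r"
    by (cases "r = 0") (simp_all add: basic_twist_nth id_counit_linear id_counit_pure)
qed

lemma h_e_commute:
  assumes "i \<noteq> j"
  shows "h * e = e * (h + 1)"
  using incl_bracket[of "h_elt i j :: ('n, 'a) splus" "e_elt i j"]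
  by (simp add: splus_bracket_h_e[OF assms] h_def e_def algebra_simps)

text \<open>Only the first leg, \<open>falling h a * falling h k\<close>, needs expanding. The
  middle leg already has the powers of e to the left of the falling factorials.\<close>

lemma cocycle_left_nth:
  "(fps_map (\<lambda>p. tensor_left p 1) (basic_twist i j) * fps_map comult_id (basic_twist i j)) $ N
    = (\<Sum>a\<le>N. \<Sum>k\<le>N - a. \<Sum>p\<le>k. cocycle_term h e a p (k - p) (N - a - k))"
proof -
  have "usplus3_scale ((-1) ^ a / fact a) (tensor3 (falling h a) (e ^ a) 1)
      * usplus3_scale ((-1) ^ (N - a) / (fact k * fact (N - a - k)))
          (tensor3 (falling h k) (falling h (N - a - k)) (e ^ (N - a)))
    = (\<Sum>p\<le>k. cocycle_term h e a p (k - p) (N - a - k))" (is "?lhs = _") if "a \<le> N" "k \<le> N - a" for a k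
  proof -
    \<comment> \<open>The factor 1/k! is kept apart, since it meets (k choose p) p! and leaves 1/(k
      - p)!.\<close>
    let ?s = "(-1) ^ N / (fact a * fact (N - a - k)) :: 'a"
    have "(-1) ^ (N - a) / (fact k * fact (N - a - k)) * ((-1) ^ a / fact a) = ?s / fact k"
      by (rule power_div_mult_power_div[OF that(1)])
    then have "?lhs = usplus3_scale (?s / fact k)
        (tensor3 (falling h a * falling h k) (e ^ a * falling h (N - a - k)) (e ^ (N - a)))"
      by (simp only: usplus3_scale_mult_left usplus3_scale_mult_right usp3.scale_scale tensor3_mult mult_1_left)
    also have "\<dots> = (\<Sum>p\<le>k. usplus3_scale (?s / fact k * of_nat ((k choose p) * (fact p * (a choose p))))
        (tensor3 (falling h (a + (k - p))) (e ^ a * falling h (N - a - k)) (e ^ (N - a))))"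
      by (simp only: falling_mult_falling of_nat_mult_usplus tensor3_sum tensor3_trilinear
          usp3.scale_sum_right usp3.scale_scale)
    also have "\<dots> = (\<Sum>p\<le>k. cocycle_term h e a p (k - p) (N - a - k))"
    proof (rule sum.cong[OF refl])
      fix p assume "p \<in> {..k}"
      then have p: "p \<le> k" by simp
      have exps: "a + p + (k - p) + (N - a - k) = N" "p + (k - p) + (N - a - k) = N - a"
        using that p by auto
      show "usplus3_scale (?s / fact k * of_nat ((k choose p) * (fact p * (a choose p))))
        (tensor3 (falling h (a + (k - p))) (e ^ a * falling h (N - a - k)) (e ^ (N - a)))
        = cocycle_term h e a p (k - p) (N - a - k)"
        by (simp only: cocycle_term_def choose_mult_fact_div_fact[OF p] exps)
    qed
    finally show ?thesis .
  qed
  then show ?thesis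
    unfolding fps_mult_nth left_twist_nth comult_id_twist_nth sum_distrib_left atLeast0AtMost
    by (intro sum.cong refl) (simp only: atMost_iff)
qed

text \<open>Here the product to be rewritten is the middle leg \<open>falling h l * e ^ b\<close>,
  which stands in the wrong order; this is where the relation between h and e enters.\<close>

lemma cocycle_right_nth:
  assumes "i \<noteq> j"
  shows "(fps_map (tensor_right 1) (basic_twist i j) * fps_map id_comult (basic_twist i j)) $ N
    = (\<Sum>l\<le>N. \<Sum>b\<le>N - l. \<Sum>p\<le>l. cocycle_term h e b p (N - l - b) (l - p))"
proof -
  have "usplus3_scale ((-1) ^ l / fact l) (tensor3 1 (falling h l) (e ^ l))
      * usplus3_scale ((-1) ^ (N - l) / (fact b * fact (N - l - b)))
          (tensor3 (falling h (N - l)) (e ^ b) (e ^ (N - l - b)))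
    = (\<Sum>p\<le>l. cocycle_term h e b p (N - l - b) (l - p))" (is "?lhs = _") if "l \<le> N" "b \<le> N - l" for l b
  proof -
    let ?s = "(-1) ^ N / (fact b * fact (N - l - b)) :: 'a"
    have "(-1) ^ (N - l) / (fact b * fact (N - l - b)) * ((-1) ^ l / fact l) = ?s / fact l"
      unfolding power_div_mult_power_div[OF that(1)] divide_divide_eq_left
      by (simp only: mult_ac)
    moreover have "e ^ l * e ^ (N - l - b) = e ^ (N - b)"
      using that by (simp only: power_add[symmetric]) simp
    ultimately have "?lhs = usplus3_scale (?s / fact l)
        (tensor3 (falling h (N - l)) (falling h l * e ^ b) (e ^ (N - b)))"
      by (simp only: usplus3_scale_mult_left usplus3_scale_mult_right usp3.scale_scale tensor3_mult mult_1_left)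
    also have "\<dots> = (\<Sum>p\<le>l. usplus3_scale (?s / fact l * of_nat ((l choose p) * (fact p * (b choose p))))
        (tensor3 (falling h (N - l)) (e ^ b * falling h (l - p)) (e ^ (N - b))))"
      by (simp only: falling_mult_power[OF h_e_commute[OF assms]] of_nat_mult_usplus tensor3_sum
          tensor3_trilinear usp3.scale_sum_right usp3.scale_scale)
    also have "\<dots> = (\<Sum>p\<le>l. cocycle_term h e b p (N - l - b) (l - p))"
    proof (rule sum.cong[OF refl])
      fix p assume "p \<in> {..l}"
      then have p: "p \<le> l" by simp
      have exps: "b + p + (N - l - b) + (l - p) = N" "p + (N - l - b) + (l - p) = N - b"
        "b + (N - l - b) = N - l"
        using that p by auto
      have "?s / fact l * of_nat ((l choose p) * (fact p * (b choose p)))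
          = (-1) ^ N * of_nat (b choose p) / (fact b * fact (N - l - b) * fact (l - p))"
        using choose_mult_fact_div_fact[OF p, of "(-1) ^ N" "fact b :: 'a" "fact (N - l - b)" "b choose p"]
        by (simp only: mult.assoc mult.commute[of "fact (l - p)"])
      then show "usplus3_scale (?s / fact l * of_nat ((l choose p) * (fact p * (b choose p))))
        (tensor3 (falling h (N - l)) (e ^ b * falling h (l - p)) (e ^ (N - b)))
        = cocycle_term h e b p (N - l - b) (l - p)"
        by (simp only: cocycle_term_def exps)
    qed
    finally show ?thesis .
  qed
  then show ?thesis
    unfolding fps_mult_nth right_twist_nth id_comult_twist_nth sum_distrib_left atLeast0AtMost
    by (intro sum.cong refl) (simp only: atMost_iff)
qed

end

text \<open>Both triple sums run over the quadruples with a + p + c + l = N: the first groups them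
  by \<open>a\<close> and k = p + c, the second by l + p and b = a.\<close>

lemma quadruple_sum_swap:
  fixes T :: "nat \<Rightarrow> nat \<Rightarrow> nat \<Rightarrow> nat \<Rightarrow> 'v::comm_monoid_add"
  shows "(\<Sum>a\<le>N. \<Sum>k\<le>N - a. \<Sum>p\<le>k. T a p (k - p) (N - a - k))
    = (\<Sum>l\<le>N. \<Sum>b\<le>N - l. \<Sum>p\<le>l. T b p (N - l - b) (l - p))"
proof -
  let ?Q = "{(a, p, c, l). a + p + c + l = N}"
  have "(\<Sum>a\<le>N. \<Sum>k\<le>N - a. \<Sum>p\<le>k. T a p (k - p) (N - a - k))
      = (\<Sum>(a, k, p)\<in>(SIGMA a:{..N}. SIGMA k:{..N - a}. {..k}). T a p (k - p) (N - a - k))"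
    by (simp add: sum.Sigma)
  also have "\<dots> = (\<Sum>(a, p, c, l)\<in>?Q. T a p c l)"
    by (rule sum.reindex_bij_witness[where i = "\<lambda>(a, p, c, l). (a, p + c, p)"
          and j = "\<lambda>(a, k, p). (a, p, k - p, N - a - k)"]) auto
  also have "\<dots> = (\<Sum>(l, b, p)\<in>(SIGMA l:{..N}. SIGMA b:{..N - l}. {..l}). T b p (N - l - b) (l - p))"
    by (rule sum.reindex_bij_witness[where j = "\<lambda>(a, p, c, l). (l + p, a, p)"
          and i = "\<lambda>(l, b, p). (b, p, N - l - b, l - p)"]) auto
  also have "\<dots> = (\<Sum>l\<le>N. \<Sum>b\<le>N - l. \<Sum>p\<le>l. T b p (N - l - b) (l - p))"
    by (simp add: sum.Sigma)
  finally show ?thesis .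
qed

lemma drinfeld_twist_basic_twist:
  assumes "i \<noteq> j"
  shows "drinfeld_twist (basic_twist i j :: ('n::finite, 'a::field_char_0) usplus2 fps)"
proof -
  let ?F = "basic_twist i j :: ('n, 'a) usplus2 fps"
  \<comment> \<open>A power series with constant coefficient 1 has a two-sided inverse.\<close>
  have "?F $ 0 = 1" by (simp add: basic_twist_nth tensor2_1)
  then have "?F * fps_right_inverse ?F 1 = 1" "fps_right_inverse ?F 1 * ?F = 1"
    by (simp_all add: fps_right_inverse fps_left_inverse'[of 1])
  moreover have "fps_map (\<lambda>p. tensor_left p 1) ?F * fps_map comult_id ?F
      = fps_map (tensor_right 1) ?F * fps_map id_comult ?F"
    by (rule fps_ext) (simp only: cocycle_left_nth cocycle_right_nth[OF assms] quadruple_sum_swap)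
  ultimately show ?thesis
    by (auto simp: drinfeld_twist_def counit_id_twist id_counit_twist)
qed

section \<open>The action on polynomials and commuting twists\<close>

lemma act_linear:
  "act x (p + q) = act x p + act x q" "act x (pm_scale c p) = pm_scale c (act x p)"
proof -
  obtain a where a: "act x = derivation a" using act[of x] by auto
  show "act x (p + q) = act x p + act x q" by (simp add: a derivation_add)
  show "act x (pm_scale c p) = pm_scale c (act x p)"
    by (simp add: a derivation_def pd_scale pm_mult_scale_right pm.scale_sum_right)
qed

definition free_act :: "(('n::finite, 'a::field) splus word \<Rightarrow>\<^sub>0 'a) \<Rightarrow> ('n, 'a) mpoly \<Rightarrow> ('n, 'a) mpoly" where
  "free_act p q = lin_ext pm_scale (\<lambda>w. foldr act (letters w) q) p"

lemma foldr_act_linear: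
  "foldr act xs (p + q) = foldr act xs p + foldr act xs q"
  "foldr act xs (pm_scale c p) = pm_scale c (foldr act xs p)"
  by (induction xs) (simp_all add: act_linear)

lemma free_act_linear:
  "free_act (p + p') q = free_act p q + free_act p' q"
  "free_act (p - p') q = free_act p q - free_act p' q"
  "free_act (pm_scale c p) q = pm_scale c (free_act p q)"
  "free_act p (q + q') = free_act p q + free_act p q'"
  "free_act p (pm_scale c q) = pm_scale c (free_act p q)"
  by (simp_all add: free_act_def pm.lin_ext_add pm.lin_ext_minus pm.lin_ext_scale foldr_act_linear
      pm.lin_ext_fun_add pm.lin_ext_fun_scale)

lemma free_act_0 [simp]: "free_act 0 q = 0" "free_act p 0 = 0"
  using free_act_linear(3)[of 0 0 q] free_act_linear(5)[of p 0 0] by simp_all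

lemma free_act_mult: "free_act (p * p') q = free_act p (free_act p' q)"
proof -
  have "free_act (single w c * p') q = free_act (single w c) (free_act p' q)" for w c
  proof (induction p' rule: pm_induct)
    case (single v d)
    show ?case by (simp add: mult_single free_act_def plus_word_def foldr_act_linear)
  qed (simp_all add: distrib_left free_act_linear)
  then show ?thesis
    by (induction p rule: pm_induct) (simp_all add: distrib_right free_act_linear)
qed

lemma free_act_letter: "free_act (letter x) q = act x q"
  by (simp add: free_act_def letter_def)

text \<open>The Lie bracket is the commutator of derivations, so the defining relations act as zero
  on every polynomial, and so do their multiples from both sides. Hence the action descends to the
  enveloping algebra.\<close>

lemma free_act_env_ideal:
  assumes "p \<in> env_ideal"
  shows "free_act p q = 0"
proof -
  have "free_act r q = 0" if "r \<in> env_relations splus_scale splus_bracket"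
    for r :: "('a, 'b) splus word \<Rightarrow>\<^sub>0 'b" and q
    using that
    by cases (simp_all add: free_act_linear free_act_mult free_act_letter plus_splus.rep_eq
        splus_scale.rep_eq splus_bracket.rep_eq)
  then have "free_act x q = 0" if "x \<in> {a * r * b | a r b. r \<in> env_relations splus_scale splus_bracket}"
    for x :: "('a, 'b) splus word \<Rightarrow>\<^sub>0 'b"
    using that by (auto simp: free_act_mult)
  then show ?thesis
    using assms unfolding free_act_def env_ideal_def ideal_gen_def
    by (rule pm.lin_ext_span_eq_0)
qed

unbundle usplus.lifting

lift_definition usplus_act :: "('n::finite, 'a::field) usplus \<Rightarrow> ('n, 'a) mpoly \<Rightarrow> ('n, 'a) mpoly" is free_act
  by (rule ext) (metis eq_iff_diff_eq_0 free_act_env_ideal free_act_linear(2))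

lemma usplus_act_incl: "usplus_act (incl x) q = act x q"
  by (simp add: incl.abs_eq usplus_act.abs_eq free_act_letter)

lemma usplus_act_mult: "usplus_act (u * v) q = usplus_act u (usplus_act v q)"
  by (induct u rule: usplus.abs_induct, induct v rule: usplus.abs_induct)
     (simp add: times_usplus.abs_eq usplus_act.abs_eq free_act_mult)

lemma usplus_act_linear:
  "usplus_act (u + v) q = usplus_act u q + usplus_act v q"
  "usplus_act (usplus_scale c u) q = pm_scale c (usplus_act u q)"
  by (induct u rule: usplus.abs_induct, (induct v rule: usplus.abs_induct)?,
      simp add: plus_usplus.abs_eq usplus_scale.abs_eq usplus_act.abs_eq free_act_linear)+

text \<open>For monomials \<open>k\<close> and \<open>l\<close>, the coefficient of \<open>k\<close>
  in u.p times the coefficient of \<open>l\<close> in v.q is bilinear in u and v, so it is defined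
  on the tensor product and vanishes if u \<otimes> v does. This allows cancelling a first factor
  that acts nontrivially.\<close>

lemma tensor2_eq_0_act:
  assumes "u \<otimes>\<^sub>2 v = 0"
  shows "usplus_act u p = 0 \<or> usplus_act v q = 0"
proof -
  define f where "f k l u v = lookup (usplus_act u p) k * lookup (usplus_act v q) l" for k l u v
  have "single (Pure2 u v) 1 - 0 \<in> ten2_ideal"
    using assms by (simp only: tensor2_def map_fun_def o_def id_apply zero_usplus2_def usplus2.abs_eq_iff)
  then have "lin_ext (*) (case_pure2 (f k l)) (single (Pure2 u v) 1) = lin_ext (*) (case_pure2 (f k l)) 0" for k l
    unfolding ten2_ideal_def
    by (rule fld.lin_ext_tensor2)
       (simp_all only: f_def usplus_act_linear lookup_add lookup_pm_scale distrib_left distrib_right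
          mult.assoc mult.left_commute)
  then have *: "lookup (usplus_act u p) k = 0 \<or> lookup (usplus_act v q) l = 0" for k l
    by (simp add: f_def)
  show ?thesis
  proof (cases "\<exists>k. lookup (usplus_act u p) k \<noteq> 0")
    case True
    with * have "lookup (usplus_act v q) l = 0" for l by blast
    then have "usplus_act v q = 0" by (intro poly_mapping_eqI) simp
    then show ?thesis ..
  next
    case False
    then have "usplus_act u p = 0" by (intro poly_mapping_eqI) simp
    then show ?thesis ..
  qed
qed

section \<open>The generators on monomials, and when two elements e commute\<close>

lemma euler_single: "euler k (single m c) = single m (of_nat (lookup m k) * c)"
proof (cases "lookup m k = 0")
  case False
  then have "single k 1 + (m - single k 1) = m"
    by (intro poly_mapping_eqI) (auto simp: lookup_add lookup_minus lookup_single when_def)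
  then show ?thesis by (simp add: euler_def pd_single Var_def mult_single)
qed (simp add: euler_def pd_single)

lemma act_h_elt_single:
  "act (h_elt i j) (single m c) = single m ((of_nat (lookup m i) - of_nat (lookup m j)) * c)"
  by (simp only: act_h_elt euler_single left_diff_distrib single_diff)

lemma act_e_elt_single:
  assumes "i \<noteq> j"
  shows "act (e_elt i j) (single m c)
    = single (single i 1 + m) ((of_nat (lookup m i) - 2 * of_nat (lookup m j)) * c)"
proof -
  have two: "2 * p = pm_scale 2 p" for p :: "('a, 'b) mpoly"
    by (simp add: pm_scale_conv_mult flip: single_numeral)
  show ?thesis
    unfolding act_e_elt[OF assms] euler_single two pm_scale_single Var_def single_diff[symmetric] mult_single
    by (simp only: left_diff_distrib mult.assoc mult_1_left)
qed

text \<open>On a monomial, e(i,j) multiplies by x_i and by a scalar that is linear in the exponents.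
  Comparing the two orders of application on the variables x_a alone already excludes the bad index
  coincidences.\<close>

lemma bracket_e_elt_eq_0D:
  assumes "i \<noteq> j" "k \<noteq> m" "(i, j) \<noteq> (k, m)"
    and 0: "splus_bracket (e_elt i j) (e_elt k m) = (0 :: ('n::finite, 'a::field_char_0) splus)"
  shows "i \<noteq> k" "j \<noteq> k" "i \<noteq> m"
proof -
  define c where "c a = (if a = i then 1 else 0) - 2 * (if a = j then 1 else 0 :: 'a)" for a
  define d where "d a = (if a = k then 1 else 0) - 2 * (if a = m then 1 else 0 :: 'a)" for a
  \<comment> \<open>\<open>c a\<close> and \<open>d a\<close> are the scalars by which e(i,j) and
    e(k,m) act on x_a. The two orders give (c k + c a) d a and (d i + d a) c a, where c a d a
    cancels.\<close>
  have *: "d a * c k = c a * d i" for a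
  proof -
    let ?x = "single (single a 1) 1 :: ('n, 'a) mpoly"
    have l: "of_nat (lookup (single b (1::nat)) b') = (if b = b' then 1 else 0 :: 'a)" for b b' :: 'n
      by (simp add: lookup_single when_def)
    have distr: "(x + y) - 2 * (z + w) = (x - 2 * z) + (y - 2 * w)" for x y z w :: 'a
      by (simp add: algebra_simps)
    have c: "act (e_elt i j) (single (single b 1) t) = single (single i 1 + single b 1) (c b * t)"
      "act (e_elt i j) (single (single b' 1 + single b 1) t)
        = single (single i 1 + (single b' 1 + single b 1)) ((c b' + c b) * t)" for b b' t
      by (simp_all only: act_e_elt_single[OF assms(1)] lookup_add of_nat_add l c_def distr)
    have d: "act (e_elt k m) (single (single b 1) t) = single (single k 1 + single b 1) (d b * t)"
      "act (e_elt k m) (single (single b' 1 + single b 1) t)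
        = single (single k 1 + (single b' 1 + single b 1)) ((d b' + d b) * t)" for b b' t
      by (simp_all only: act_e_elt_single[OF assms(2)] lookup_add of_nat_add l d_def distr)
    have "act (e_elt i j) (act (e_elt k m) ?x) = act (e_elt k m) (act (e_elt i j) ?x)"
      using arg_cong[OF 0, of "\<lambda>X. act X ?x"] by (simp add: splus_bracket.rep_eq zero_splus.rep_eq)
    then have "single (single i 1 + (single k 1 + single a 1)) ((c k + c a) * d a)
        = (single (single k 1 + (single i 1 + single a 1)) ((d i + d a) * c a) :: ('n, 'a) mpoly)"
      by (simp only: c d mult_1_right)
    then have "(c k + c a) * d a = (d i + d a) * c a"
      by (metis add.left_commute lookup_single_eq)
    then show ?thesis by (simp add: algebra_simps)
  qed
  have c: "c i = 1" "a \<noteq> i \<Longrightarrow> c a = (if a = j then - 2 else 0)" for a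
    using assms(1) by (simp_all add: c_def)
  have d: "d k = 1" "a \<noteq> k \<Longrightarrow> d a = (if a = m then - 2 else 0)" for a
    using assms(2) by (simp_all add: d_def)
  show ik: "i \<noteq> k"
  proof
    assume "i = k"
    \<comment> \<open>For i = k both c k and d i are 1. Then d j = c j = -2 forces j = m, against
      the pairs being different.\<close>
    with *[of j] c(1) d(1) have "d j = c j" by simp
    with c(2)[of j] d(2)[of j] \<open>i = k\<close> assms(1-3) show False by (simp split: if_splits)
  qed
  show jk: "j \<noteq> k"
  proof
    assume "j = k"
    with c(2)[of k] ik have "c k = - 2" by simp
    with *[of k] d(1) have "d i = 1" by simp
    \<comment> \<open>Away from \<open>k\<close> the function \<open>d\<close> takes only the values
      -2 and 0, neither of which is 1 in characteristic 0.\<close>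
    with d(2)[OF ik] show False by (simp split: if_splits)
  qed
  show "i \<noteq> m"
  proof
    assume "i = m"
    with d(2)[OF ik] have "d i = - 2" by simp
    moreover have "c k = 0" using c(2)[of k] ik jk by simp
    ultimately show False using *[of i] c(1) by simp
  qed
qed

section \<open>Commutation of the generators\<close>

lemma euler_commute: "euler k (euler l p) = euler l (euler k p)"
  by (cases "k = l") (simp_all add: euler_def pd_mult pd_Var pd_commute[of k l] mult.left_commute)

lemma euler_Var_mult: "k \<noteq> l \<Longrightarrow> euler l (Var k * p) = Var k * euler l p"
  by (simp add: euler_def pd_mult pd_Var algebra_simps)

lemma euler_diff: "euler k (p - q) = euler k p - euler k q"
  by (simp add: euler_def pd_diff algebra_simps)

lemma euler_double: "euler k (2 * p) = 2 * euler k p"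
  by (simp add: euler_def pd_mult algebra_simps)

lemma incl_0: "incl 0 = 0"
  using incl_add[of 0 0] by simp

lemma incl_commuteI:
  assumes "splus_bracket x y = 0"
  shows "incl x * incl y = incl y * incl x"
  by (metis assms incl_0 incl_bracket right_minus_eq)

lemma h_h_commute: "incl (h_elt i j) * incl (h_elt k m) = incl (h_elt k m) * incl (h_elt i j)"
proof (rule incl_commuteI)
  show "splus_bracket (h_elt i j) (h_elt k m) = (0 :: ('a, 'b) splus)"
    unfolding act_inject[symmetric] splus_bracket.rep_eq zero_splus.rep_eq
    by (simp add: act_h_elt euler_diff euler_commute[of k] euler_commute[of m] fun_eq_iff)
qed

text \<open>e(k,m) changes only the exponent of x_k, and the weight measured by h(i,j) does not
  involve that exponent.\<close>

lemma h_e_cross_commute: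
  assumes "k \<noteq> m" "i \<noteq> k" "j \<noteq> k"
  shows "incl (h_elt i j) * incl (e_elt k m) = incl (e_elt k m) * incl (h_elt i j)"
proof (rule incl_commuteI)
  show "splus_bracket (h_elt i j) (e_elt k m) = (0 :: ('a, 'b) splus)"
    unfolding act_inject[symmetric] splus_bracket.rep_eq zero_splus.rep_eq
    by (simp only: act_h_elt act_e_elt[OF assms(1)] euler_Var_mult[OF assms(2)[symmetric]]
        euler_Var_mult[OF assms(3)[symmetric]] euler_diff euler_double euler_commute[of i k]
        euler_commute[of i m] euler_commute[of j k] euler_commute[of j m])
       (simp add: algebra_simps)
qed

lemma e_bracket_of_twist_commute:
  assumes "i \<noteq> j" "k \<noteq> m"
    and FG: "basic_twist i j * basic_twist k m = basic_twist k m * (basic_twist i j :: ('n::finite, 'a::field_char_0) usplus2 fps)"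
  shows "splus_bracket (e_elt i j) (e_elt k m) = (0 :: ('n, 'a) splus)"
proof -
  let ?h = "\<lambda>i j. incl (h_elt i j) :: ('n, 'a) usplus" and ?e = "\<lambda>i j. incl (e_elt i j) :: ('n, 'a) usplus"
  have "(\<Sum>r=0..2. (basic_twist i j $ r) * (basic_twist k m $ (2 - r) :: ('n, 'a) usplus2))
      = (\<Sum>r=0..2. (basic_twist k m $ r) * (basic_twist i j $ (2 - r)))"
    using arg_cong[OF FG, of "\<lambda>F. F $ 2"] by (simp only: fps_mult_nth)
  \<comment> \<open>The terms r = 0 and r = 2 have a factor 1 and cancel; in the term r = 1 the two
    signs multiply to 1.\<close>
  then have "(?h i j * ?h k m) \<otimes>\<^sub>2 (?e i j * ?e k m) = (?h k m * ?h i j) \<otimes>\<^sub>2 (?e k m * ?e i j)"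
    by (simp add: numeral_2_eq_2 basic_twist_nth falling_1 tensor2_1 tensor2_mult)
  then have "(?h i j * ?h k m) \<otimes>\<^sub>2 (?e i j * ?e k m) = (?h i j * ?h k m) \<otimes>\<^sub>2 (?e k m * ?e i j)"
    by (simp only: h_h_commute)
  then have "(?h i j * ?h k m) \<otimes>\<^sub>2 incl (splus_bracket (e_elt i j) (e_elt k m)) = 0"
    using tensor2_bilinear(2)[of "?h i j * ?h k m" "?e i j * ?e k m - ?e k m * ?e i j" "?e k m * ?e i j"]
    by (simp add: incl_bracket)
  note zero = tensor2_eq_0_act[OF this]
  \<comment> \<open>On a monomial with pairwise different exponents, h(i,j) and h(k,m) act by
    differences of distinct naturals, nonzero in characteristic 0. So the first tensor factor does
    not act as zero, and the bracket has to.\<close>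
  obtain f :: "'n \<Rightarrow> nat" where "inj f"
    using finite_imp_inj_to_nat_seg[OF finite_UNIV] by blast
  define \<alpha> where "\<alpha> = (\<Sum>k\<in>UNIV. single k (f k))"
  have \<alpha>: "lookup \<alpha> k = f k" for k
    by (simp add: \<alpha>_def lookup_sum lookup_single when_def)
  have "lookup (usplus_act (?h i j * ?h k m) (single \<alpha> 1)) \<alpha> \<noteq> 0"
    using assms(1,2) \<open>inj f\<close>
    by (simp add: usplus_act_mult usplus_act_incl act_h_elt_single \<alpha> inj_eq)
  then have "usplus_act (?h i j * ?h k m) (single \<alpha> 1) \<noteq> 0" by auto
  with zero have "act (splus_bracket (e_elt i j) (e_elt k m)) q = (0 :: ('n, 'a) mpoly)" for q
    by (auto simp: usplus_act_incl)
  then show ?thesis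
    by (simp add: fun_eq_iff zero_splus.rep_eq flip: act_inject)
qed

section \<open>From commuting generators to commuting twists\<close>

lemma fps_mult_commuteI:
  fixes F G :: "'r::ring_1 fps"
  assumes "\<And>a b. F $ a * G $ b = G $ b * F $ a"
  shows "F * G = G * F"
proof (rule fps_ext)
  fix n
  have "(F * G) $ n = (\<Sum>a=0..n. G $ (n - a) * F $ a)"
    by (simp add: fps_mult_nth assms)
  also have "\<dots> = (\<Sum>a=0..n. G $ a * F $ (n - a))"
    by (rule sum.reindex_bij_witness[where i = "\<lambda>a. n - a" and j = "\<lambda>a. n - a"]) auto
  finally show "(F * G) $ n = (G * F) $ n" by (simp add: fps_mult_nth)
qed

lemma prod_list_commute:
  fixes y :: "'r::monoid_mult"
  shows "(\<And>x. x \<in> set xs \<Longrightarrow> x * y = y * x) \<Longrightarrow> prod_list xs * y = y * prod_list xs"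
  by (induction xs) (auto simp: mult.assoc, simp flip: mult.assoc)

lemma falling_power_commute:
  fixes x y :: "'r::ring_1"
  assumes "x * y = y * x"
  shows "falling x r * falling y s = falling y s * falling x r"
    "falling x r * y ^ s = y ^ s * falling x r"
    "x ^ r * falling y s = falling y s * x ^ r"
    "x ^ r * y ^ s = y ^ s * x ^ r"
  using assms by (metis commute_falling commute_power)+

lemma basic_twist_cross_commute:
  fixes i j k m :: "'n::finite"
  assumes "i \<noteq> j" "k \<noteq> m"
    and ne: "basic_twist i j \<noteq> (basic_twist k m :: ('n, 'a::field_char_0) usplus2 fps)"
    and FG: "basic_twist i j * basic_twist k m = basic_twist k m * (basic_twist i j :: ('n, 'a) usplus2 fps)"
  shows "fps_map (\<lambda>p. tensor_left p 1) (basic_twist i j :: ('n, 'a) usplus2 fps) * fps_map comult_id (basic_twist k m)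
      = fps_map comult_id (basic_twist k m) * fps_map (\<lambda>p. tensor_left p 1) (basic_twist i j)" (is ?L)
    and "fps_map (tensor_right 1) (basic_twist i j :: ('n, 'a) usplus2 fps) * fps_map id_comult (basic_twist k m)
      = fps_map id_comult (basic_twist k m) * fps_map (tensor_right 1) (basic_twist i j)" (is ?R)
proof -
  let ?h = "\<lambda>i j. incl (h_elt i j) :: ('n, 'a) usplus" and ?e = "\<lambda>i j. incl (e_elt i j) :: ('n, 'a) usplus"
  note b = e_bracket_of_twist_commute[OF assms(1,2) FG]
  have "(i, j) \<noteq> (k, m)" using ne by auto
  note ineq = bracket_e_elt_eq_0D[OF assms(1,2) this b]
  \<comment> \<open>The pair h(i,j), e(k,m) uses i \<noteq> k and j \<noteq> k; the pair e(i,j),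
    h(k,m) uses i \<noteq> k and i \<noteq> m. The case j = m is allowed.\<close>
  have c: "?h i j * ?h k m = ?h k m * ?h i j" "?h i j * ?e k m = ?e k m * ?h i j"
    "?e i j * ?h k m = ?h k m * ?e i j" "?e i j * ?e k m = ?e k m * ?e i j"
    using ineq assms(1,2)
    by (auto intro: h_h_commute h_e_cross_commute h_e_cross_commute[symmetric] incl_commuteI[OF b])
  note com = c[THEN falling_power_commute(1)] c[THEN falling_power_commute(2)]
    c[THEN falling_power_commute(3)] c[THEN falling_power_commute(4)]
  show ?L
    by (rule fps_mult_commuteI)
       (simp only: left_twist_nth comult_id_twist_nth sum_distrib_left sum_distrib_right
         usplus3_scale_mult_left usplus3_scale_mult_right tensor3_mult com mult_1_left mult_1_right
         usp3.scale_sum_right usp3.scale_left_commute)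
  show ?R
    by (rule fps_mult_commuteI)
       (simp only: right_twist_nth id_comult_twist_nth sum_distrib_left sum_distrib_right
         usplus3_scale_mult_left usplus3_scale_mult_right tensor3_mult com mult_1_left mult_1_right
         usp3.scale_sum_right usp3.scale_left_commute)
qed

theorem corollary4p2:
  fixes i j :: "nat \<Rightarrow> 'n::finite" and m :: nat
    and F :: "nat \<Rightarrow> ('n, 'a::field_char_0) usplus2 fps"
  assumes "\<And>s. s \<in> {1..m} \<Longrightarrow> i s \<noteq> j s"
    and "\<And>s. s \<in> {1..m} \<Longrightarrow> F s = basic_twist (i s) (j s)"
    and "\<And>k s. k \<in> {1..m} \<Longrightarrow> s \<in> {1..m} \<Longrightarrow> k \<noteq> s \<Longrightarrow> F k \<noteq> F s"
    and "\<And>k s. k \<in> {1..m} \<Longrightarrow> s \<in> {1..m} \<Longrightarrow> k \<noteq> s \<Longrightarrow> F k * F s - F s * F k = 0"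
  shows "drinfeld_twist (prod_list (map F [1..<m + 1]))"
proof -
  \<comment> \<open>The induction runs over arbitrary lists of distinct indices, a class closed
    under taking tails. The head is the left factor, so it has to be compared with every later
    index.\<close>
  have "drinfeld_twist (prod_list (map F ks))" if "distinct ks" "set ks \<subseteq> {1..m}" for ks
    using that
  proof (induction ks)
    case Nil
    then show ?case by (simp add: drinfeld_twist_1)
  next
    case (Cons k ks)
    have k: "k \<in> {1..m}" using Cons.prems by simp
    have com: "fps_map (\<lambda>p. tensor_left p 1) (F s) * fps_map comult_id (F k)
        = fps_map comult_id (F k) * fps_map (\<lambda>p. tensor_left p 1) (F s)"
      "fps_map (tensor_right 1) (F s) * fps_map id_comult (F k)
        = fps_map id_comult (F k) * fps_map (tensor_right 1) (F s)" if "s \<in> set ks" for s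
    proof -
      have s: "s \<in> {1..m}" "s \<noteq> k" using that Cons.prems by auto
      have ne: "basic_twist (i s) (j s) \<noteq> (basic_twist (i k) (j k) :: ('n, 'a) usplus2 fps)"
        and FG: "basic_twist (i s) (j s) * basic_twist (i k) (j k)
          = basic_twist (i k) (j k) * (basic_twist (i s) (j s) :: ('n, 'a) usplus2 fps)"
        using assms(3,4)[OF s(1) k s(2)] by (simp_all add: assms(2)[OF s(1)] assms(2)[OF k])
      note com = basic_twist_cross_commute[OF assms(1)[OF s(1)] assms(1)[OF k] ne FG]
      show "fps_map (\<lambda>p. tensor_left p 1) (F s) * fps_map comult_id (F k)
          = fps_map comult_id (F k) * fps_map (\<lambda>p. tensor_left p 1) (F s)"
        "fps_map (tensor_right 1) (F s) * fps_map id_comult (F k)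
          = fps_map id_comult (F k) * fps_map (tensor_right 1) (F s)"
        unfolding assms(2)[OF s(1)] assms(2)[OF k] by (fact com)+
    qed
    have "drinfeld_twist (F k * prod_list (map F ks))"
    proof (rule drinfeld_twist_mult)
      show "drinfeld_twist (F k)"
        using drinfeld_twist_basic_twist[OF assms(1)[OF k]] by (simp add: assms(2)[OF k])
      show "drinfeld_twist (prod_list (map F ks))" using Cons by simp
      show "fps_map (\<lambda>p. tensor_left p 1) (prod_list (map F ks)) * fps_map comult_id (F k)
          = fps_map comult_id (F k) * fps_map (\<lambda>p. tensor_left p 1) (prod_list (map F ks))"
        \<comment> \<open>The map F \<mapsto> F \<otimes> 1 is multiplicative, so the image of the
          tail splits into factors that each commute with the coproduct side of the head.\<close>
        unfolding hom_prod_list[OF unital_ring_hom_fps_map[OF hom_tensor_left]]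
        by (rule prod_list_commute) (auto simp: com)
      show "fps_map (tensor_right 1) (prod_list (map F ks)) * fps_map id_comult (F k)
          = fps_map id_comult (F k) * fps_map (tensor_right 1) (prod_list (map F ks))"
        unfolding hom_prod_list[OF unital_ring_hom_fps_map[OF hom_tensor_right]]
        by (rule prod_list_commute) (auto simp: com)
    qed
    then show ?case by simp
  qed
  moreover have "set [1..<m + 1] \<subseteq> {1..m}" by auto
  ultimately show ?thesis using distinct_upt by blast
qed

end
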